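(* Let $J=\mathbb{Z}^+$, let $X_1,X_2$ be Hilbert spaces, and let $A_{11}(n)\in\mathcal{L}(X_1)$, $A_{12}(n)\in\mathcal{L}(X_2,X_1)$, $A_{22}(n)\in\mathcal{L}(X_2)$ for $n\in\mathbb{Z}^+$, where $A_{ii}(n)$ is invertible for $i=1,2$ and $n\in\mathbb{Z}^+$. Suppose that the block triangular system $$x(n+1)=\begin{pmatrix}A_{11}(n)&A_{12}(n)\\0&A_{22}(n)\end{pmatrix}x(n),\quad n\in\mathbb{Z}^+,$$ on $X_1\times X_2$ admits an exponential dichotomy. Let $\Phi_{ii}$ be the cocycle of $x_i(n+1)=A_{ii}(n)x_i(n)$, $n\in\mathbb{Z}^+$. Then the block diagonal system $$x(n+1)=\begin{pmatrix}A_{11}(n)&0\\0&A_{22}(n)\end{pmatrix}x(n),\quad n\in\mathbb{Z}^+,$$ admits an exponential dichotomy if and only if the following two conditions hold: (1) $\mathcal{S}_2=\{v_2\in X_2:\ \sup_{n\in\mathbb{Z}^+}\|\Phi_{22}(n,0)v_2\|<+\infty\}$ is complemented in $X_2$; (2) the subspace $\{v_1\in X_1:\ \sup_{n\in\mathbb{Z}^+}\|(\Phi_{11}(n,0)^* )^{-1}v_1\|<+\infty\}$ is complemented in $X_1$.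
   Context: $\mathbb{Z}^+$ is the set of nonnegative integers. $\mathcal{L}(X,Y)$ denotes the bounded linear operators $X\to Y$, and $\mathcal{L}(X)=\mathcal{L}(X,X)$; $T^*$ is the Hilbert space adjoint of $T$. $X_1\times X_2$ carries the norm $\|(x_1,x_2)\|=\max\{\|x_1\|,\|x_2\|\}$ (equivalent to its Hilbert norm). A (not necessarily closed) subspace $S$ of a Banach space $X$ is complemented if there is a closed subspace $Z\subset X$ with $X=S\oplus Z$ (algebraic direct sum). Exponential dichotomy. Let $X$ be a Banach space and $(A(n))_{n\in\mathbb{Z}^+}\subset\mathcal{L}(X)$. The cocycle of the system $x(n+1)=A(n)x(n)$, $n\in\mathbb{Z}^+$, is $\Phi(m,n)=A(m-1)\cdots A(n)$ for $m>n$ and $\Phi(n,n)=\mathrm{Id}$. The system admits an exponential dichotomy if there exist (bounded) projections $(P(n))_{n\in\mathbb{Z}^+}\subset\mathcal{L}(X)$ and constants $K,\alpha>0$ such that: (i) for every $n\in\mathbb{Z}^+$, $A(n)P(n)=P(n+1)A(n)$ and $A(n)|_{\mathcal{N}P(n)}:\mathcal{N}P(n)\to\mathcal{N}P(n+1)$ is invertible, where $\mathcal{N}P(n)$ is the kernel of $P(n)$; (ii) $\|\Phi(m,n)P(n)\|\le Ke^{-\alpha(m-n)}$ for $m\ge n\ge0$; (iii) $\|\Phi(m,n)(\mathrm{Id}-P(n))\|\le Ke^{-\alpha(n-m)}$ for $0\le m\le n$, where for $m\le n$, $\Phi(m,n):=(\Phi(n,m)|_{\mathcal{N}P(m)})^{-1}:\mathcal{N}P(n)\to\mathcal{N}P(m)$.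 *)

theory Defs
  imports "HOL-Analysis.Analysis"
begin

section \<open>Hilbert spaces over the real or complex numbers\<close>

text \<open>
  The library only has real inner product spaces, so the scalar field is made explicit to cover real
  and complex Hilbert spaces at once. Up to isomorphism, a type of class \<open>real_normed_field\<close> is
  \<open>\<real>\<close> or \<open>\<complex>\<close> (Gelfand--Mazur), and a Hilbert space over it is a complete real inner product
  space with a compatible isometric scalar multiplication. For complex scalars, \<open>inner\<close> is the real
  part of the Hermitian product, which polarization recovers. The adjoint of a complex-linear
  operator with respect to the real part is its Hermitian adjoint, so the library's \<open>adjoint\<close>
  is the Hilbert space adjoint in both cases.
\<close>

locale hilbert_space = vector_space scale
  for scale :: "'k::real_normed_field \<Rightarrow> 'a::{real_inner, banach} \<Rightarrow> 'a" +
  assumes scale_of_real: "scale (of_real r) x = r *\<^sub>R x"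
    and norm_scale: "norm (scale c x) = norm c * norm x"

lemma hilbert_space_scaleR: "hilbert_space (scaleR :: real \<Rightarrow> 'a::{real_inner, banach} \<Rightarrow> 'a)"
  by unfold_locales (auto simp: algebra_simps)

lemma hilbert_space_complex: "hilbert_space ((*) :: complex \<Rightarrow> complex \<Rightarrow> complex)"
  by unfold_locales (auto simp: algebra_simps norm_mult scaleR_conv_of_real)

definition complemented :: "('k::field \<Rightarrow> 'a::real_normed_vector \<Rightarrow> 'a) \<Rightarrow> 'a set \<Rightarrow> bool" where
  "complemented s S \<longleftrightarrow> module.subspace s S \<and>
     (\<exists>Z. module.subspace s Z \<and> closed Z \<and> S \<inter> Z = {0} \<and> {u + z |u z. u \<in> S \<and> z \<in> Z} = UNIV)"

definition invertible_blinfun ::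
  "('a::real_normed_vector \<Rightarrow>\<^sub>L 'b::real_normed_vector) \<Rightarrow> bool" where
  "invertible_blinfun T \<longleftrightarrow> (\<exists>S. S o\<^sub>L T = id_blinfun \<and> T o\<^sub>L S = id_blinfun)"

section \<open>Exponential dichotomies on the nonnegative integers\<close>

text \<open>Only the values \<open>cocycle A m n\<close> with \<open>n \<le> m\<close> are meaningful.\<close>

fun cocycle :: "(nat \<Rightarrow> 'a::real_normed_vector \<Rightarrow>\<^sub>L 'a) \<Rightarrow> nat \<Rightarrow> nat \<Rightarrow> 'a \<Rightarrow>\<^sub>L 'a" where
  "cocycle A 0 n = id_blinfun"
| "cocycle A (Suc m) n = (if n \<le> m then A m o\<^sub>L cocycle A m n else id_blinfun)"

abbreviation blinfun_kernel ::
  "('a::real_normed_vector \<Rightarrow>\<^sub>L 'b::real_normed_vector) \<Rightarrow> 'a set" where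
  "blinfun_kernel T \<equiv> {x. blinfun_apply T x = 0}"

text \<open>For \<open>m \<le> n\<close>: the inverse of \<open>cocycle A n m\<close> restricted to the kernel of \<open>P m\<close>.\<close>

definition cocycle_back ::
  "(nat \<Rightarrow> 'a::real_normed_vector \<Rightarrow>\<^sub>L 'a) \<Rightarrow> (nat \<Rightarrow> 'a \<Rightarrow>\<^sub>L 'a) \<Rightarrow> nat \<Rightarrow> nat \<Rightarrow> 'a \<Rightarrow> 'a" where
  "cocycle_back A P m n = inv_into (blinfun_kernel (P m)) (blinfun_apply (cocycle A n m))"

text \<open>
  The operators \<open>P n\<close> are linear over the scalar field of \<open>s\<close>. The backward estimate is written
  pointwise because \<open>cocycle_back\<close> is a plain function; boundedness of the inverses of the
  restricted operators is part of that estimate. The notion is invariant under passing to an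
  equivalent norm (only the constant \<open>K\<close> changes), so on products the library norm may be used
  instead of the maximum norm, see \<open>norm_prod_max_equiv\<close> below.
\<close>

definition exponential_dichotomy ::
  "('k::field \<Rightarrow> 'a::banach \<Rightarrow> 'a) \<Rightarrow> (nat \<Rightarrow> 'a \<Rightarrow>\<^sub>L 'a) \<Rightarrow> bool" where
  "exponential_dichotomy s A \<longleftrightarrow>
     (\<exists>(P :: nat \<Rightarrow> 'a \<Rightarrow>\<^sub>L 'a) (K::real) (\<alpha>::real). K > 0 \<and> \<alpha> > 0 \<and>
        (\<forall>n. Vector_Spaces.linear s s (blinfun_apply (P n)) \<and> P n o\<^sub>L P n = P n) \<and>
        (\<forall>n. A n o\<^sub>L P n = P (Suc n) o\<^sub>L A n \<and>
             bij_betw (blinfun_apply (A n)) (blinfun_kernel (P n)) (blinfun_kernel (P (Suc n)))) \<and>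
        (\<forall>m n. n \<le> m \<longrightarrow>
             norm (cocycle A m n o\<^sub>L P n) \<le> K * exp (- \<alpha> * (real m - real n))) \<and>
        (\<forall>m n. m \<le> n \<longrightarrow>
             (\<forall>x. norm (cocycle_back A P m n (x - P n x))
                    \<le> K * exp (- \<alpha> * (real n - real m)) * norm x)))"

lemma norm_prod_max_equiv:
  fixes x :: "'a::real_normed_vector \<times> 'b::real_normed_vector"
  shows "max (norm (fst x)) (norm (snd x)) \<le> norm x"
    and "norm x \<le> 2 * max (norm (fst x)) (norm (snd x))"
  using norm_fst_le[of "fst x" "snd x"] norm_snd_le[of "snd x" "fst x"]
    norm_Pair_le[of "fst x" "snd x"]
  by auto

section \<open>Block triangular operators\<close>

definition block_upper ::
  "('a::real_normed_vector \<Rightarrow>\<^sub>L 'a) \<Rightarrow> ('b::real_normed_vector \<Rightarrow>\<^sub>L 'a) \<Rightarrow> ('b \<Rightarrow>\<^sub>L 'b) \<Rightarrow>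
     ('a \<times> 'b) \<Rightarrow>\<^sub>L ('a \<times> 'b)" where
  "block_upper A B D = Blinfun (\<lambda>x. (A (fst x) + B (snd x), D (snd x)))"

lemma blinfun_apply_block_upper:
  "blinfun_apply (block_upper A B D) (x, y) = (A x + B y, D y)"
proof -
  have "bounded_linear (\<lambda>x. (A (fst x) + B (snd x), D (snd x)))"
    by (intro bounded_linear_Pair bounded_linear_add bounded_linear_fst bounded_linear_snd
        bounded_linear_compose[OF blinfun.bounded_linear_right])
  then show ?thesis
    by (simp add: block_upper_def bounded_linear_Blinfun_apply)
qed

end

theory Submission
  imports Defs
begin

text \<open>
  The compression \<open>R m y = snd (P m (0, y))\<close> of the dichotomy projections of the triangular system
  splits every vector into a part decaying forwards and a part decaying backwards under
  \<open>\<Phi>\<^sub>2\<^sub>2\<close>, although it is in general not a projection. Such a splitting turns into a dichotomy as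
  soon as the subspace of bounded orbits has a closed complement: a Baire category argument bounds
  the orbits uniformly, and the splitting then forces them to decay with the original rate. The
  adjoints of the compressions \<open>fst (P m (x, 0))\<close> give a splitting of the dual system
  \<open>(\<Phi>\<^sub>1\<^sub>1(n,0)\<^sup>*)\<^sup>-\<^sup>1\<close> in the same way, and dichotomies pass between a system and its dual.
\<close>

section \<open>Open mapping and Riesz representation\<close>

text \<open>The dichotomy projections need not be block triangular, so their diagonal corners need
  not be projections. What survives depends on which coordinate map intertwines the evolutions.
  \<open>snd\<close> does, so estimates for the second corner hold with the corner applied before
  the transition. \<open>fst\<close> does not, but the inclusion \<open>(x, 0)\<close> does; it
  gives estimates with the corner applied after the transition, and adjoints reverse that order.
  This is why the first block enters through its dual and condition (2) speaks of inverse adjoints.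
  What a splitting lacks is one choice of unstable directions at time 0 that serves all times
  \<open>m\<close>; a closed complement of the bounded orbits is such a choice. The subspace of
  bounded orbits is not known to be closed, so continuity of the projection along the complement has
  to be proved together with the uniform bound on orbits. The conditions on the two blocks separate
  because a block diagonal system is dichotomic exactly when both blocks are.\<close>

text \<open>Baire's theorem only puts a ball into the closure of \<open>C\<close>. The assumption
  \<open>cs\<close> on convex series replaces closedness: successive approximation writes each small
  vector as a series of elements of \<open>C\<close> with weights
  \<open>1/2, 1/4, ...\<close>.\<close>

lemma cs_closed_absorbing_contains_ball:
  fixes C :: "'a::banach set"
  assumes "convex C" and sym: "\<And>x. x \<in> C \<Longrightarrow> - x \<in> C"
    and absorb: "\<And>x. \<exists>k. x /\<^sub>R real (Suc k) \<in> C"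
    and cs: "\<And>c x. (\<And>i. c i \<in> C) \<Longrightarrow> (\<lambda>i. (1/2) ^ Suc i *\<^sub>R c i) sums x \<Longrightarrow> x \<in> C"
  shows "\<exists>r>0. ball 0 r \<subseteq> C"
proof -
  define D where "D = closure C"
  have symD: "- x \<in> D" if "x \<in> D" for x
  proof -
    have "(\<lambda>x. - x) ` closure C \<subseteq> closure C"
      using sym closure_subset[of C] by (intro image_closure_subset) (auto intro!: continuous_intros)
    then show ?thesis
      using that D_def by auto
  qed
  \<comment> \<open>Dilates of the closed set \<open>D\<close>, which cover the space because
    \<open>C\<close> is absorbing; \<open>Suc k\<close> keeps the factor nonzero.\<close>
  define F where "F k = {x. x /\<^sub>R real (Suc k) \<in> D}" for k :: nat
  have closedF: "closed (F k)" for k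
  proof -
    have "closed ((\<lambda>x. x /\<^sub>R real (Suc k)) -` D)"
      unfolding D_def by (intro closed_vimage closed_closure continuous_intros)
    then show ?thesis
      by (simp add: F_def vimage_def)
  qed
  have "\<Union>(range F) = UNIV"
    using absorb closure_subset[of C] unfolding F_def D_def by blast
  then have "\<exists>k. interior (F k) \<noteq> {}"
    using Baire_category_alt[of "euclidean :: 'a topology" "range F"] closedF
      completely_metrizable_space_euclidean by fastforce
  then obtain k y where "y \<in> interior (F k)"
    by auto
  then obtain e' where e': "e' > 0" "ball y e' \<subseteq> F k"
    using mem_interior by blast
  define w where "w = y /\<^sub>R real (Suc k)"
  define e where "e = e' / real (Suc k)"
  have "e > 0"
    using e' by (simp add: e_def)
  have ball_w: "w + x \<in> D" if "norm x < e" for x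
  proof -
    have "norm (real (Suc k) *\<^sub>R x) < e'"
      using that unfolding e_def norm_scaleR by (simp add: field_simps del: of_nat_Suc)
    then have "y + real (Suc k) *\<^sub>R x \<in> F k"
      by (intro subsetD[OF e'(2)]) (simp add: dist_norm del: of_nat_Suc)
    then show ?thesis
      by (simp add: F_def w_def scaleR_add_right del: of_nat_Suc)
  qed
  \<comment> \<open>Symmetry and convexity move the ball from \<open>w\<close> to the origin:
    \<open>x\<close> is the midpoint of \<open>w + x\<close> and \<open>- (w - x)\<close>.\<close>
  have ball_D: "x \<in> D" if "norm x < e" for x
  proof -
    have "- (w + (- x)) \<in> D" "w + x \<in> D"
      using ball_w[of x] symD[OF ball_w[of "- x"]] that by auto
    moreover have "convex D"
      unfolding D_def by (rule convex_closure[OF \<open>convex C\<close>])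
    ultimately have "(1/2) *\<^sub>R (- (w + (- x))) + (1/2) *\<^sub>R (w + x) \<in> D"
      by (intro convexD) auto
    moreover have "(1/2) *\<^sub>R (- (w + (- x))) + (1/2) *\<^sub>R (w + x) = x"
      unfolding scaleR_add_right[symmetric] using scaleR_half_double[of x] by (simp add: algebra_simps)
    ultimately show ?thesis
      by simp
  qed
  have step: "\<exists>c\<in>C. norm (2 *\<^sub>R x - c) < e/2" if "norm x < e/2" for x
  proof -
    have "2 *\<^sub>R x \<in> closure C"
      using ball_D[of "2 *\<^sub>R x"] that D_def by simp
    then show ?thesis
      using closure_approachable[of "2 *\<^sub>R x" C] \<open>e > 0\<close>
      by (metis dist_commute dist_norm half_gt_zero)
  qed
  then obtain g where g: "\<And>x. norm x < e/2 \<Longrightarrow> g x \<in> C"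
    "\<And>x. norm x < e/2 \<Longrightarrow> norm (2 *\<^sub>R x - g x) < e/2"
    by metis
  have "x \<in> C" if "norm x < e/2" for x
  proof -
    \<comment> \<open>\<open>X n\<close> is the error after \<open>n\<close> approximations,
      magnified by \<open>2 ^ n\<close>. By the choice of \<open>g\<close> it never leaves the ball
      of radius \<open>e/2\<close>, so the true error tends to 0.\<close>
    define X where "X = rec_nat x (\<lambda>_ y. 2 *\<^sub>R y - g y)"
    have X0: "X 0 = x" and XS: "X (Suc n) = 2 *\<^sub>R X n - g (X n)" for n
      by (simp_all add: X_def)
    have Xe: "norm (X n) < e/2" for n
      by (induction n) (use that g X0 XS in auto)
    have psum: "(\<Sum>i<n. (1/2) ^ Suc i *\<^sub>R g (X i)) = x - (1/2) ^ n *\<^sub>R X n" for n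
      by (induction n) (simp_all add: X0 XS algebra_simps)
    have "(\<lambda>n. (1/2) ^ n *\<^sub>R X n) \<longlonglongrightarrow> 0"
    proof (rule Lim_null_comparison)
      show "\<forall>\<^sub>F n in sequentially. norm ((1/2) ^ n *\<^sub>R X n) \<le> (1/2) ^ n * (e/2)"
        using Xe by (auto intro!: always_eventually mult_left_mono less_imp_le)
      show "(\<lambda>n. (1/2) ^ n * (e/2)) \<longlonglongrightarrow> 0"
        by (intro tendsto_mult_left_zero LIMSEQ_power_zero) auto
    qed
    then have "(\<lambda>i. (1/2) ^ Suc i *\<^sub>R g (X i)) sums x"
      unfolding sums_def psum using tendsto_diff[OF tendsto_const[of x]] by fastforce
    then show ?thesis
      using cs[of "\<lambda>i. g (X i)" x] g Xe by blast
  qed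
  then show ?thesis
    using \<open>e > 0\<close> by (intro exI[of _ "e/2"]) auto
qed

text \<open>
  The representing vector minimizes \<open>\<lambda>x. (norm x)\<^sup>2 - 2 * f x\<close>; minimizing sequences are Cauchy by
  the parallelogram law.
\<close>

lemma Riesz_representation:
  fixes f :: "'a::{real_inner,banach} \<Rightarrow> real"
  assumes "bounded_linear f"
  shows "\<exists>w. \<forall>x. f x = inner x w"
proof -
  interpret f: bounded_linear f by fact
  define g where "g x = (norm x)\<^sup>2 - 2 * f x" for x
  obtain B where B: "\<And>x. norm (f x) \<le> norm x * B" "B > 0"
    using f.pos_bounded by blast
  have lower: "- B\<^sup>2 \<le> g x" for x
  proof -
    have "f x \<le> norm x * B"
      using B(1)[of x] by auto
    moreover have "(norm x)\<^sup>2 - 2 * (norm x * B) + B\<^sup>2 = (norm x - B)\<^sup>2"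
      by (simp add: power2_eq_square algebra_simps)
    moreover have "0 \<le> (norm x - B)\<^sup>2"
      by simp
    ultimately show ?thesis
      unfolding g_def by linarith
  qed
  define d where "d = (INF x. g x)"
  have d_le: "d \<le> g x" for x
    unfolding d_def by (intro cINF_lower bdd_belowI2[where m="- B\<^sup>2"]) (auto simp: lower)
  have "\<exists>x. g x < d + 1 / real (Suc n)" for n
    using cInf_lessD[of "range g" "d + 1 / real (Suc n)"] by (auto simp: d_def)
  then obtain X where X: "\<And>n. g (X n) < d + 1 / real (Suc n)"
    by metis
  have par: "(norm (x - y))\<^sup>2 = 2 * g x + 2 * g y - 4 * g ((x + y) /\<^sub>R 2)" for x y
    by (simp add: g_def f.scaleR f.add power2_norm_eq_inner inner_simps inner_commute algebra_simps)
  have close: "(norm (X m - X n))\<^sup>2 \<le> 2 / real (Suc m) + 2 / real (Suc n)" for m n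
    using par[of "X m" "X n"] X[of m] X[of n] d_le[of "(X m + X n) /\<^sub>R 2"] by simp
  have "Cauchy X"
  proof (rule metric_CauchyI)
    fix e :: real assume "0 < e"
    obtain N where N: "4 / e\<^sup>2 < real N"
      using reals_Archimedean2 by blast
    have "dist (X m) (X n) < e" if "m \<ge> N" "n \<ge> N" for m n
    proof -
      have "2 / real (Suc k) < e\<^sup>2 / 2" if "k \<ge> N" for k
      proof -
        have "4 / e\<^sup>2 < real (Suc k)"
          using N that by simp
        then show ?thesis
          using \<open>0 < e\<close> by (simp add: field_simps)
      qed
      from this[OF that(1)] this[OF that(2)] have "(norm (X m - X n))\<^sup>2 < e\<^sup>2"
        using close[of m n] by linarith
      then show ?thesis
        using \<open>0 < e\<close> by (simp add: dist_norm power2_less_imp_less)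
    qed
    then show "\<exists>M. \<forall>m\<ge>M. \<forall>n\<ge>M. dist (X m) (X n) < e"
      by blast
  qed
  then obtain w where w: "X \<longlonglongrightarrow> w"
    using Cauchy_convergent convergent_def by blast
  have "(\<lambda>n. g (X n)) \<longlonglongrightarrow> g w"
    unfolding g_def by (intro tendsto_intros w f.tendsto)
  moreover have "(\<lambda>n. d + 1 / real (Suc n)) \<longlonglongrightarrow> d + 0"
    using LIMSEQ_inverse_real_of_nat by (intro tendsto_intros) (simp add: inverse_eq_divide)
  ultimately have "g w \<le> d + 0"
    by (rule LIMSEQ_le) (use X less_imp_le in blast)
  then have min: "g w \<le> g x" for x
    using d_le[of x] by simp
  have "f x = inner x w" for x
  proof -
    define c where "c = f x - inner x w"
    \<comment> \<open>Moving from \<open>w\<close> to \<open>w + t *\<^sub>R x\<close> changes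
      \<open>g\<close> by \<open>- 2 * t * c + t\<^sup>2 * (norm x)\<^sup>2\<close>. This
      \<open>t\<close> is optimal with \<open>(norm x)\<^sup>2 + 1\<close> in place of
      \<open>(norm x)\<^sup>2\<close>; the added 1 also covers \<open>x = 0\<close>.\<close>
    define t where "t = c / ((norm x)\<^sup>2 + 1)"
    have "(norm x)\<^sup>2 + 1 > 0"
      by (simp add: add_nonneg_pos)
    have "g (w + t *\<^sub>R x) = g w - 2 * t * c + t\<^sup>2 * (norm x)\<^sup>2"
      unfolding g_def power2_norm_eq_inner c_def
      by (simp add: f.add f.scaleR inner_simps inner_commute power2_eq_square algebra_simps)
    then have "2 * t * c \<le> t\<^sup>2 * (norm x)\<^sup>2"
      using min[of "w + t *\<^sub>R x"] by simp
    also have "\<dots> \<le> t\<^sup>2 * ((norm x)\<^sup>2 + 1)"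
      by (simp add: mult_left_mono)
    also have "\<dots> = t * c"
      using \<open>(norm x)\<^sup>2 + 1 > 0\<close> by (simp add: t_def power2_eq_square)
    finally have "t * c \<le> 0"
      by (simp add: mult.commute)
    then have "c\<^sup>2 / ((norm x)\<^sup>2 + 1) \<le> 0"
      by (simp add: t_def power2_eq_square)
    then have "c = 0"
      using \<open>(norm x)\<^sup>2 + 1 > 0\<close> by (simp add: divide_le_0_iff)
    then show ?thesis
      by (simp add: c_def)
  qed
  then show ?thesis
    by blast
qed

section \<open>Adjoints of bounded operators\<close>

text \<open>\<open>adjoint\<close> is a choice term, so its defining identity is available only once
  some adjoint is known to exist; Riesz representation of \<open>\<lambda>x. inner (f x) y\<close>
  provides one.\<close>

lemma inner_adjoint_eq:
  fixes f :: "'a::{real_inner,banach} \<Rightarrow> 'b::real_inner"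
  assumes "bounded_linear f"
  shows "inner (f x) y = inner x (adjoint f y)"
proof -
  have "\<exists>w. \<forall>x. inner (f x) y = inner x w" for y
    by (rule Riesz_representation) (intro bounded_linear_compose[OF bounded_linear_inner_left assms, unfolded o_def])
  then obtain g where "\<And>x y. inner (f x) y = inner x (g y)"
    by metis
  then show ?thesis
    using adjoint_unique[of f g] by metis
qed

text \<open>Test the identity with \<open>x = G y\<close>. Stated for any pair in adjoint relation,
  it dualizes estimates on composites of transitions and splitting operators directly.\<close>

lemma norm_adjoint_le:
  assumes adj: "\<And>x y. inner (F x) y = inner x (G y)"
    and bound: "\<And>x. norm (F x) \<le> B * norm x" and "0 \<le> B"
  shows "norm (G y) \<le> B * norm y"
proof (cases "G y = 0")
  case True
  then show ?thesis
    using \<open>0 \<le> B\<close> by simp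
next
  case False
  have "(norm (G y))\<^sup>2 = inner (F (G y)) y"
    by (simp add: adj power2_norm_eq_inner)
  also have "\<dots> \<le> norm (F (G y)) * norm y"
    by (rule norm_cauchy_schwarz)
  also have "\<dots> \<le> B * norm (G y) * norm y"
    by (intro mult_right_mono bound) auto
  finally show ?thesis
    using False by (simp add: power2_eq_square mult.commute mult.left_commute)
qed

section \<open>Splittings and dichotomy projections\<close>

text \<open>With \<open>V n\<close> inverse to \<open>U n\<close>, the transition from time
  \<open>m\<close> to time \<open>n\<close> is \<open>U n (V m x)\<close> in either time
  direction.\<close>

locale evolution =
  fixes U V :: "nat \<Rightarrow> 'a::banach \<Rightarrow> 'a"
  assumes bounded_linear_U: "bounded_linear (U n)"
    and bounded_linear_V: "bounded_linear (V n)"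
    and U_V [simp]: "U n (V n x) = x"
    and V_U [simp]: "V n (U n x) = x"
    and U_0 [simp]: "U 0 x = x"
begin

lemma V_0 [simp]: "V 0 x = x"
  using V_U[of 0 x] by (simp del: V_U)

lemmas U_add = linear_add[OF bounded_linear.linear[OF bounded_linear_U]]
  and U_diff = linear_diff[OF bounded_linear.linear[OF bounded_linear_U]]
  and V_add = linear_add[OF bounded_linear.linear[OF bounded_linear_V]]
  and V_diff = linear_diff[OF bounded_linear.linear[OF bounded_linear_V]]

end

definition bounded_orbits :: "(nat \<Rightarrow> 'a \<Rightarrow> 'a::real_normed_vector) \<Rightarrow> 'a set" where
  "bounded_orbits U = {v. bdd_above (range (\<lambda>n. norm (U n v)))}"

text \<open>The operators \<open>R m\<close> need be neither projections nor compatible with the evolution.\<close>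

definition decay_splitting ::
  "(nat \<Rightarrow> 'a \<Rightarrow> 'a::real_normed_vector) \<Rightarrow> (nat \<Rightarrow> 'a \<Rightarrow> 'a) \<Rightarrow> (nat \<Rightarrow> 'a \<Rightarrow> 'a)
    \<Rightarrow> real \<Rightarrow> real \<Rightarrow> bool" where
  "decay_splitting U V R K \<alpha> \<longleftrightarrow>
     (\<forall>m n x. m \<le> n \<longrightarrow> norm (U n (V m (R m x))) \<le> K * exp (- \<alpha> * (real n - real m)) * norm x) \<and>
     (\<forall>m n x. n \<le> m \<longrightarrow> norm (U n (V m (x - R m x))) \<le> K * exp (- \<alpha> * (real m - real n)) * norm x)"

text \<open>Invariance is built in: the projection at time \<open>m\<close> is the conjugate of the
  single projection \<open>Q\<close> at time 0. For an evolution, the case \<open>n = m\<close> of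
  the estimates bounds these conjugates uniformly.\<close>

definition dichotomy_projection ::
  "(nat \<Rightarrow> 'a \<Rightarrow> 'a::real_normed_vector) \<Rightarrow> (nat \<Rightarrow> 'a \<Rightarrow> 'a) \<Rightarrow> ('a \<Rightarrow> 'a)
    \<Rightarrow> real \<Rightarrow> real \<Rightarrow> bool" where
  "dichotomy_projection U V Q K \<alpha> \<longleftrightarrow> bounded_linear Q \<and> (\<forall>x. Q (Q x) = Q x) \<and>
     decay_splitting U V (\<lambda>m x. U m (Q (V m x))) K \<alpha>"

lemma bounded_orbitsI:
  assumes "\<And>n. m \<le> n \<Longrightarrow> norm (U n v) \<le> c"
  shows "v \<in> bounded_orbits U"
proof -
  have "UNIV = {..<m} \<union> {m..}"
    by auto
  then have "range (\<lambda>n. norm (U n v)) = (\<lambda>n. norm (U n v)) ` {..<m} \<union> (\<lambda>n. norm (U n v)) ` {m..}"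
    by (metis image_Un)
  moreover have "bdd_above ((\<lambda>n. norm (U n v)) ` {m..})"
    using assms by (intro bdd_aboveI2) auto
  ultimately show ?thesis
    by (simp add: bounded_orbits_def)
qed

lemma bounded_orbitsE:
  assumes "v \<in> bounded_orbits U"
  obtains c where "\<And>n. norm (U n v) \<le> c" "0 < c"
proof -
  from assms obtain c where "\<And>n. norm (U n v) \<le> c"
    by (auto simp: bounded_orbits_def bdd_above_def)
  then show thesis
    by (intro that[of "max c 1"]) (auto simp: le_max_iff_disj)
qed

lemma half_series_bound:
  fixes a :: "nat \<Rightarrow> 'a::banach"
  assumes "\<And>i. norm (a i) \<le> 1"
  shows "summable (\<lambda>i. (1/2) ^ Suc i *\<^sub>R a i)" "norm (\<Sum>i. (1/2) ^ Suc i *\<^sub>R a i) \<le> 1"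
proof -
  have le: "norm ((1/2) ^ Suc i *\<^sub>R a i) \<le> (1/2) ^ Suc i" for i
    using mult_left_mono[OF assms[of i], of "(1/2) ^ Suc i"] by simp
  show "summable (\<lambda>i. (1/2) ^ Suc i *\<^sub>R a i)"
    by (rule summable_comparison_test'[OF sums_summable[OF power_half_series], of 0]) (rule le)
  show "norm (\<Sum>i. (1/2) ^ Suc i *\<^sub>R a i) \<le> 1"
    using norm_suminf_le[OF le sums_summable[OF power_half_series]] sums_unique[OF power_half_series]
    by simp
qed

text \<open>
  The subspace need not be closed a priori; boundedness of the projection and uniform boundedness of
  the orbits come together from a Baire argument applied to the set of all \<open>u + z\<close> with
  \<open>norm (U n u) \<le> 1\<close> for all \<open>n\<close> and \<open>norm z \<le> 1\<close>, where \<open>z\<close> lies in the complement.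
\<close>

lemma complemented_bounded_orbits_projection:
  fixes U :: "nat \<Rightarrow> 'a::banach \<Rightarrow> 'a" and s :: "'k::real_normed_field \<Rightarrow> 'a \<Rightarrow> 'a"
  assumes U: "\<And>n. bounded_linear (U n)" "\<And>x. U 0 x = x"
    and s: "vector_space s" "\<And>r x. s (of_real r) x = r *\<^sub>R x"
    and S: "complemented s (bounded_orbits U)"
  obtains Q M where "bounded_linear Q" "\<And>c x. Q (s c x) = s c (Q x)"
    "\<And>x. Q x \<in> bounded_orbits U" "\<And>x. x \<in> bounded_orbits U \<Longrightarrow> Q x = x"
    "\<And>n x. norm (U n (Q x)) \<le> M * norm x" "0 < M"
proof -
  interpret vector_space s by (fact s(1))
  let ?S = "bounded_orbits U"
  from S obtain Z where Z: "subspace Z" "closed Z" "?S \<inter> Z = {0}"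
    "{u + z |u z. u \<in> ?S \<and> z \<in> Z} = UNIV" and sub: "subspace ?S"
    unfolding complemented_def by blast
  have real_subspace: "Real_Vector_Spaces.subspace T" if "subspace T" for T
    using that unfolding Real_Vector_Spaces.subspace_def subspace_def s(2)[symmetric] by blast
  note rS = real_subspace[OF sub] and rZ = real_subspace[OF Z(1)]
  have ex: "\<exists>u. u \<in> ?S \<and> v - u \<in> Z" for v
  proof -
    have "v \<in> {u + z |u z. u \<in> ?S \<and> z \<in> Z}"
      using Z(4) by simp
    then show ?thesis by force
  qed
  have uniq: "u = u'" if "u \<in> ?S" "v - u \<in> Z" "u' \<in> ?S" "v - u' \<in> Z" for u u' v
  proof -
    have "u - u' \<in> ?S"
      by (intro subspace_diff[OF sub] that)
    moreover have "(v - u') - (v - u) \<in> Z"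
      by (intro subspace_diff[OF Z(1)] that)
    moreover have "(v - u') - (v - u) = u - u'"
      by simp
    ultimately have "u - u' \<in> {0}"
      unfolding Z(3)[symmetric] by simp
    then show ?thesis
      by simp
  qed
  \<comment> \<open>The algebraic projection along \<open>Z\<close>. Uniqueness of the decomposition
    makes it linear; its continuity comes only from the ball found below.\<close>
  from ex obtain Q where Q: "\<And>v. Q v \<in> ?S" "\<And>v. v - Q v \<in> Z"
    by metis
  have Q_eqI: "Q v = u" if "u \<in> ?S" "v - u \<in> Z" for u v
    using uniq that Q by blast
  have Q_add: "Q (x + y) = Q x + Q y" for x y
  proof (rule Q_eqI)
    show "Q x + Q y \<in> ?S"
      using Q subspace_add[OF sub] by blast
    have "(x - Q x) + (y - Q y) \<in> Z"
      using Q subspace_add[OF Z(1)] by blast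
    then show "x + y - (Q x + Q y) \<in> Z"
      by (simp add: algebra_simps)
  qed
  have Q_s: "Q (s c x) = s c (Q x)" for c x
  proof (rule Q_eqI)
    show "s c (Q x) \<in> ?S"
      using Q subspace_scale[OF sub] by blast
    have "s c (x - Q x) \<in> Z"
      using Q subspace_scale[OF Z(1)] by blast
    then show "s c x - s c (Q x) \<in> Z"
      by (simp add: scale_right_diff_distrib)
  qed
  have Q_id: "Q x = x" if "x \<in> ?S" for x
    using that subspace_0[OF Z(1)] by (intro Q_eqI) auto
  have Q_scaleR: "Q (r *\<^sub>R x) = r *\<^sub>R Q x" for r x
    using Q_s[of "of_real r" x] by (simp add: s(2))
  have linQ: "linear Q"
    by (intro linearI Q_add Q_scaleR)
  note U_lin = bounded_linear.linear[OF U(1)]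
  note lin_simps = linear_add[OF linQ] linear_scale[OF linQ] linear_neg[OF linQ] linear_diff[OF linQ]
    linear_add[OF U_lin] linear_scale[OF U_lin] linear_neg[OF U_lin] linear_diff[OF U_lin]
  define C where "C = {v. (\<forall>n. norm (U n (Q v)) \<le> 1) \<and> norm (v - Q v) \<le> 1}"
  have "\<exists>r>0. ball 0 r \<subseteq> C"
  proof (rule cs_closed_absorbing_contains_ball)
    have comb: "norm (a *\<^sub>R x + b *\<^sub>R y) \<le> 1"
      if "0 \<le> a" "0 \<le> b" "a + b = 1" "norm x \<le> 1" "norm y \<le> 1" for a b and x y :: 'a
      using convexD[OF convex_cball[of "0::'a" 1], of x y a b] that by simp
    show "convex C"
    proof (rule convexI)
      fix x y :: 'a and a b :: real
      assume *: "x \<in> C" "y \<in> C" "0 \<le> a" "0 \<le> b" "a + b = 1"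
      have "norm (U n (Q (a *\<^sub>R x + b *\<^sub>R y))) \<le> 1" for n
        using comb[OF *(3-5), of "U n (Q x)" "U n (Q y)"] * by (simp add: C_def lin_simps)
      moreover have "norm (a *\<^sub>R x + b *\<^sub>R y - Q (a *\<^sub>R x + b *\<^sub>R y)) \<le> 1"
        using comb[OF *(3-5), of "x - Q x" "y - Q y"] * by (simp add: C_def lin_simps algebra_simps)
      ultimately show "a *\<^sub>R x + b *\<^sub>R y \<in> C"
        by (simp add: C_def)
    qed
    show "- x \<in> C" if "x \<in> C" for x
      using that norm_minus_commute[of x "Q x"] by (simp add: C_def lin_simps)
    show "\<exists>k. x /\<^sub>R real (Suc k) \<in> C" for x
    proof -
      obtain c where c: "\<And>n. norm (U n (Q x)) \<le> c" "0 < c"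
        using bounded_orbitsE[OF Q(1)] by blast
      obtain k where k: "max c (norm (x - Q x)) < real k"
        using reals_Archimedean2 by blast
      have small: "norm (y /\<^sub>R real (Suc k)) \<le> 1" if "norm y \<le> real k" for y :: 'a
      proof -
        have "norm (y /\<^sub>R real (Suc k)) = norm y / real (Suc k)"
          by (simp add: divide_inverse mult.commute del: of_nat_Suc)
        then show ?thesis
          using that by simp
      qed
      have "norm (U n (Q (x /\<^sub>R real (Suc k)))) \<le> 1" for n
        using small[of "U n (Q x)"] c(1)[of n] k by (simp add: lin_simps del: of_nat_Suc)
      moreover have "norm (x /\<^sub>R real (Suc k) - Q (x /\<^sub>R real (Suc k))) \<le> 1"
        using small[of "x - Q x"] k by (simp add: lin_simps scaleR_diff_right del: of_nat_Suc)
      ultimately show ?thesis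
        by (auto simp: C_def)
    qed
    show "x \<in> C" if c: "\<And>i. c i \<in> C" and x: "(\<lambda>i. (1/2) ^ Suc i *\<^sub>R c i) sums x" for c x
    proof -
      have cQ: "norm (Q (c i)) \<le> 1" for i
        using c[of i] U(2) by (auto simp: C_def dest: spec[of _ 0])
      define u where "u = (\<Sum>i. (1/2) ^ Suc i *\<^sub>R Q (c i))"
      have u: "(\<lambda>i. (1/2) ^ Suc i *\<^sub>R Q (c i)) sums u"
        unfolding u_def by (intro summable_sums half_series_bound(1) cQ)
      have Un: "norm (U n u) \<le> 1" for n
      proof -
        have "(\<lambda>i. (1/2) ^ Suc i *\<^sub>R U n (Q (c i))) sums U n u"
          using bounded_linear.sums[OF U(1) u] by (simp only: linear_scale[OF U_lin])
        then show ?thesis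
          using half_series_bound(2)[of "\<lambda>i. U n (Q (c i))"] c sums_unique by (force simp: C_def)
      qed
      have diff: "(\<lambda>i. (1/2) ^ Suc i *\<^sub>R (c i - Q (c i))) sums (x - u)"
        using sums_diff[OF x u] by (simp only: scaleR_diff_right)
      \<comment> \<open>Closedness is known for \<open>Z\<close> only; that \<open>u\<close> belongs
        to the bounded orbits follows from the uniform bound \<open>Un\<close> instead. Together
        they identify \<open>u\<close> as \<open>Q x\<close>.\<close>
      have "x - u \<in> Z"
      proof (rule closed_sequentially[OF Z(2) _ diff[unfolded sums_def]])
        show "(\<Sum>i<n. (1/2) ^ Suc i *\<^sub>R (c i - Q (c i))) \<in> Z" for n
          by (intro Real_Vector_Spaces.subspace_sum[OF rZ] Real_Vector_Spaces.subspace_scale[OF rZ] Q(2))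
      qed
      moreover have "u \<in> ?S"
        by (rule bounded_orbitsI) (rule Un)
      ultimately have "Q x = u"
        by (intro Q_eqI)
      moreover have "norm (x - u) \<le> 1"
        using half_series_bound(2)[of "\<lambda>i. c i - Q (c i)"] c sums_unique[OF diff] by (simp add: C_def)
      ultimately show ?thesis
        using Un by (simp add: C_def)
    qed
  qed
  then obtain r where r: "r > 0" "ball 0 r \<subseteq> C"
    by blast
  \<comment> \<open>The ball is open, so \<open>x\<close> is rescaled to norm \<open>r / 2\<close>,
    whence the constant \<open>2 / r\<close>. The case \<open>n = 0\<close> makes \<open>Q\<close>
    bounded.\<close>
  have bound: "norm (U n (Q x)) \<le> (2 / r) * norm x" for n x
  proof (cases "x = 0")
    case True
    then show ?thesis
      using lin_simps(2)[of 0 x] linear_0[OF U_lin] by simp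
  next
    case False
    then have "(r / (2 * norm x)) *\<^sub>R x \<in> ball 0 r"
      using r(1) by simp
    then have "norm (U n (Q ((r / (2 * norm x)) *\<^sub>R x))) \<le> 1"
      using r(2) C_def by blast
    then show ?thesis
      using r(1) False by (simp add: lin_simps field_simps)
  qed
  have "bounded_linear Q"
    using bound[of 0] U(2) linQ by (intro bounded_linear_intro[of Q "2 / r"]) (auto simp: lin_simps mult.commute)
  then show thesis
    using that[of Q "2 / r"] Q_s Q Q_id bound r(1) by simp
qed

text \<open>Each \<open>V k (R k x)\<close> has a bounded orbit and is fixed by \<open>Q\<close>, so
  it differs from \<open>Q (V k x)\<close> only by \<open>Q p\<close> with
  \<open>p = V k (x - R k x)\<close>, which is small. It remains to see that orbits in the range of
  \<open>Q\<close> decay at rate \<alpha>. Split such an orbit at a large fixed time: the remainder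
  at time 0 has at most half the norm of the original vector and again lies in the range, so
  absorbing it costs only a constant.\<close>

lemma dichotomy_projection_of_decay_splitting:
  fixes U :: "nat \<Rightarrow> 'a::banach \<Rightarrow> 'a" and s :: "'k::real_normed_field \<Rightarrow> 'a \<Rightarrow> 'a"
  assumes ev: "evolution U V"
    and s: "vector_space s" "\<And>r x. s (of_real r) x = r *\<^sub>R x"
    and S: "complemented s (bounded_orbits U)"
    and split: "decay_splitting U V R K \<alpha>" and "0 < K" "0 < \<alpha>"
  obtains Q K' where "0 < K'" "dichotomy_projection U V Q K' \<alpha>" "\<And>c x. Q (s c x) = s c (Q x)"
proof -
  interpret evolution U V by (fact ev)
  obtain Q M where Q: "bounded_linear Q" and Q_s: "\<And>c x. Q (s c x) = s c (Q x)"
    and Q_S: "\<And>x. Q x \<in> bounded_orbits U" and Q_id: "\<And>x. x \<in> bounded_orbits U \<Longrightarrow> Q x = x"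
    and M: "\<And>n x. norm (U n (Q x)) \<le> M * norm x" "0 < M"
    using complemented_bounded_orbits_projection[OF bounded_linear_U U_0 s S] by blast
  have subS: "module.subspace s (bounded_orbits U)"
    using S by (simp add: complemented_def)
  interpret s: vector_space s by (fact s(1))
  interpret Q: bounded_linear Q by (fact Q)
  have fwd: "norm (U n (V m (R m x))) \<le> K * exp (- \<alpha> * (real n - real m)) * norm x" if "m \<le> n" for m n x
    using split that unfolding decay_splitting_def by blast
  have bwd: "norm (U n (V m (x - R m x))) \<le> K * exp (- \<alpha> * (real m - real n)) * norm x" if "n \<le> m" for m n x
    using split that unfolding decay_splitting_def by blast
  have bwd_0: "norm (V m (x - R m x)) \<le> K * exp (- \<alpha> * real m) * norm x" for m x
    using bwd[of 0 m x] by simp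
  have R_S: "V m (R m x) \<in> bounded_orbits U" for m x
  proof (rule bounded_orbitsI)
    fix n assume "m \<le> n"
    then have "exp (- \<alpha> * (real n - real m)) \<le> 1"
      using \<open>0 < \<alpha>\<close> by simp
    then have "K * exp (- \<alpha> * (real n - real m)) * norm x \<le> K * 1 * norm x"
      using \<open>0 < K\<close> by (intro mult_right_mono mult_left_mono) auto
    then show "norm (U n (V m (R m x))) \<le> K * 1 * norm x"
      using fwd[OF \<open>m \<le> n\<close>] order_trans by blast
  qed
  define N where "N n = onorm (\<lambda>v. U n (Q v))" for n
  have blUQ: "bounded_linear (\<lambda>v. U n (Q v))" for n
    by (rule bounded_linear_compose[OF bounded_linear_U Q])
  have N: "norm (U n (Q v)) \<le> N n * norm v" and N0: "0 \<le> N n" for n v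
    unfolding N_def using onorm[OF blUQ] onorm_pos_le[OF blUQ] by auto
  have NM: "N n \<le> M" for n
    unfolding N_def by (rule onorm_bound) (use M in auto)
  \<comment> \<open>Chosen so that
    \<open>2 * K * M < \<alpha> * real m < exp (\<alpha> * real m)\<close>, which gives the factor
    1/2.\<close>
  obtain m :: nat where m: "2 * K * M / \<alpha> < real m"
    using reals_Archimedean2 by blast
  have half: "K * exp (- \<alpha> * real m) * M \<le> 1/2"
  proof -
    have "2 * K * M < \<alpha> * real m"
      using m \<open>0 < \<alpha>\<close> by (simp add: field_simps)
    also have "\<dots> < exp (\<alpha> * real m)"
      using exp_ge_add_one_self[of "\<alpha> * real m"] by linarith
    finally show ?thesis
      by (simp add: exp_minus field_simps)
  qed
  \<comment> \<open>Up to the part decaying from time \<open>m\<close> on, an element of the range of \<open>Q\<close> is halved, so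
    \<open>N n\<close> can be absorbed.\<close>
  have N_decay: "N n \<le> 2 * K * M * exp (- \<alpha> * (real n - real m))" if "m \<le> n" for n
  proof -
    have "norm (U n (Q v)) \<le> (K * M * exp (- \<alpha> * (real n - real m)) + N n / 2) * norm v" for v
    proof -
      define x where "x = U m (Q v)"
      define w where "w = V m (x - R m x)"
      have Qv: "Q v = V m (R m x) + w"
        by (simp add: w_def x_def V_diff)
      have "w = Q v - V m (R m x)"
        by (simp add: Qv)
      then have "w \<in> bounded_orbits U"
        using s.subspace_diff[OF subS Q_S R_S] by simp
      then have Qw: "Q w = w"
        by (rule Q_id)
      have x: "norm x \<le> M * norm v"
        unfolding x_def by (rule M)
      have "norm w \<le> K * exp (- \<alpha> * real m) * norm x"
        unfolding w_def by (rule bwd_0)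
      also have "\<dots> \<le> K * exp (- \<alpha> * real m) * (M * norm v)"
        using x \<open>0 < K\<close> by (intro mult_left_mono) auto
      also have "\<dots> \<le> 1/2 * norm v"
        using mult_right_mono[OF half norm_ge_zero[of v]] by (simp add: mult.assoc)
      finally have w: "norm w \<le> 1/2 * norm v" .
      have "norm (U n (Q v)) \<le> norm (U n (V m (R m x))) + norm (U n (Q w))"
        unfolding Qv U_add by (simp add: norm_triangle_ineq Qw)
      also have "norm (U n (V m (R m x))) \<le> K * exp (- \<alpha> * (real n - real m)) * norm x"
        by (rule fwd[OF that])
      also have "\<dots> \<le> K * exp (- \<alpha> * (real n - real m)) * (M * norm v)"
        using x \<open>0 < K\<close> by (intro mult_left_mono) auto
      also have "norm (U n (Q w)) \<le> N n * norm w"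
        by (rule N)
      also have "\<dots> \<le> N n * (1/2 * norm v)"
        by (rule mult_left_mono[OF w N0])
      finally show ?thesis
        by (simp add: algebra_simps)
    qed
    then have "N n \<le> K * M * exp (- \<alpha> * (real n - real m)) + N n / 2"
      unfolding N_def[of n] using N0[of n] \<open>0 < K\<close> M(2)
      by (intro onorm_bound) (auto simp: N_def[of n])
    then show ?thesis
      by simp
  qed
  \<comment> \<open>\<open>exp (\<alpha> * real m)\<close> moves the start of the decay from time
    \<open>m\<close> to time 0. The summand \<open>2 * K\<close> serves times from \<open>m\<close>
    on; the 1 serves earlier times, where only \<open>N n \<le> M\<close> is known.\<close>
  define C where "C = (2 * K + 1) * M * exp (\<alpha> * real m)"
  have "0 < C"
    using \<open>0 < K\<close> M(2) by (simp add: C_def)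
  have Q_decay: "norm (U n (Q v)) \<le> C * exp (- \<alpha> * real n) * norm v" for n v
  proof -
    have "N n \<le> C * exp (- \<alpha> * real n)"
    proof (cases "m \<le> n")
      case True
      have "N n \<le> 2 * K * M * exp (- \<alpha> * (real n - real m))"
        by (rule N_decay[OF True])
      also have "\<dots> \<le> (2 * K + 1) * M * exp (- \<alpha> * (real n - real m))"
        using M(2) by (intro mult_right_mono) auto
      also have "\<dots> = C * exp (- \<alpha> * real n)"
        by (simp add: C_def algebra_simps flip: exp_add)
      finally show ?thesis .
    next
      case False
      have "N n \<le> M * 1"
        using NM by simp
      also have "\<dots> \<le> M * exp (\<alpha> * real m - \<alpha> * real n)"
        using False M(2) \<open>0 < \<alpha>\<close> by (intro mult_left_mono) (auto simp: mult_left_mono)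
      also have "\<dots> \<le> ((2 * K + 1) * M) * exp (\<alpha> * real m - \<alpha> * real n)"
        using M(2) \<open>0 < K\<close> by (intro mult_right_mono) auto
      also have "\<dots> = C * exp (- \<alpha> * real n)"
        by (simp add: C_def mult.assoc flip: exp_add)
      finally show ?thesis .
    qed
    then show ?thesis
      by (rule order_trans[OF N mult_right_mono[OF _ norm_ge_zero]])
  qed
  define K' where "K' = K + C * K"
  have "decay_splitting U V (\<lambda>m x. U m (Q (V m x))) K' \<alpha>"
    unfolding decay_splitting_def
  proof (intro conjI allI impI)
    fix k n :: nat and x
    define p where "p = V k (x - R k x)"
    have Vx: "V k x = V k (R k x) + p"
      by (simp add: p_def V_diff)
    have QVx: "Q (V k x) = V k (R k x) + Q p"
      unfolding Vx Q.add by (simp add: Q_id R_S)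
    \<comment> \<open>Two decays multiply: \<open>p\<close> is small because it was transported back
      from time \<open>k\<close> to 0, and \<open>Q p\<close> then decays up to time
      \<open>n\<close>. The exponent \<open>n + k\<close> dominates both \<open>n - k\<close> and
      \<open>k - n\<close>, so one bound corrects both estimates.\<close>
    have rem: "norm (U n (Q p)) \<le> C * K * exp (- \<alpha> * (real n + real k)) * norm x"
    proof -
      have "norm (U n (Q p)) \<le> C * exp (- \<alpha> * real n) * norm p"
        by (rule Q_decay)
      also have "\<dots> \<le> C * exp (- \<alpha> * real n) * (K * exp (- \<alpha> * real k) * norm x)"
        unfolding p_def using \<open>0 < C\<close> by (intro mult_left_mono bwd_0) auto
      also have "\<dots> = C * K * exp (- \<alpha> * (real n + real k)) * norm x"
        by (simp add: distrib_left exp_add exp_diff exp_minus field_simps)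
      finally show ?thesis .
    qed
    have rem': "norm (U n (Q p)) \<le> C * K * exp (- \<alpha> * t) * norm x" if "t \<le> real n + real k" for t
    proof -
      have "exp (- \<alpha> * (real n + real k)) \<le> exp (- \<alpha> * t)"
        using that \<open>0 < \<alpha>\<close> by simp
      then have "C * K * exp (- \<alpha> * (real n + real k)) * norm x \<le> C * K * exp (- \<alpha> * t) * norm x"
        using \<open>0 < C\<close> \<open>0 < K\<close> by (intro mult_right_mono mult_left_mono) auto
      then show ?thesis
        using rem by linarith
    qed
    show "norm (U n (V k (U k (Q (V k x))))) \<le> K' * exp (- \<alpha> * (real n - real k)) * norm x" if "k \<le> n"
    proof -
      have "norm (U n (V k (U k (Q (V k x))))) \<le> norm (U n (V k (R k x))) + norm (U n (Q p))"
        unfolding V_U unfolding QVx U_add by (rule norm_triangle_ineq)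
      then show ?thesis
        using fwd[OF that, of x] rem'[of "real n - real k"] by (simp add: K'_def algebra_simps)
    qed
    show "norm (U n (V k (x - U k (Q (V k x))))) \<le> K' * exp (- \<alpha> * (real k - real n)) * norm x" if "n \<le> k"
    proof -
      have "V k (x - U k (Q (V k x))) = p - Q p"
        by (simp add: V_diff QVx) (simp add: Vx)
      then have "norm (U n (V k (x - U k (Q (V k x))))) \<le> norm (U n p) + norm (U n (Q p))"
        by (simp add: U_diff norm_triangle_ineq4)
      then show ?thesis
        using bwd[OF that, of x] rem'[of "real k - real n"] by (simp add: K'_def p_def algebra_simps)
    qed
  qed
  moreover have "0 < K'"
    using \<open>0 < C\<close> \<open>0 < K\<close> by (simp add: K'_def add_pos_pos)
  ultimately show thesis
    using that[of K' Q] Q Q_s Q_id Q_S by (simp add: dichotomy_projection_def)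
qed

text \<open>Along a bounded orbit, the backward estimate from time \<open>m\<close> to 0 bounds
  \<open>x - Q x\<close> by a constant times \<open>exp (- \<alpha> * real m)\<close> for every
  \<open>m\<close>, which forces \<open>x = Q x\<close>.\<close>

lemma bounded_orbits_eq_range:
  assumes ev: "evolution U V" and dich: "dichotomy_projection U V Q K \<alpha>" and "0 < \<alpha>"
  shows "bounded_orbits U = range Q"
proof (intro equalityI subsetI)
  interpret evolution U V by (fact ev)
  have Q: "bounded_linear Q" "\<And>x. Q (Q x) = Q x"
    and split: "decay_splitting U V (\<lambda>m x. U m (Q (V m x))) K \<alpha>"
    using dich by (auto simp: dichotomy_projection_def)
  interpret Q: bounded_linear Q by (fact Q)
  have fwd: "norm (U n (Q x)) \<le> K * exp (- \<alpha> * real n) * norm x" for n x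
    using split[unfolded decay_splitting_def, THEN conjunct1, rule_format, of 0 n x] by simp
  have bwd: "norm (x - Q x) \<le> K * exp (- \<alpha> * real m) * norm (U m x)" for m x
  proof -
    have "norm (U 0 (V m (U m x - U m (Q (V m (U m x)))))) \<le> K * exp (- \<alpha> * (real m - real 0)) * norm (U m x)"
      using split unfolding decay_splitting_def by blast
    then show ?thesis
      by (simp add: V_diff)
  qed
  fix x
  show "x \<in> bounded_orbits U" if "x \<in> range Q"
  proof -
    have "K * exp (- \<alpha> * real n) * norm x \<le> \<bar>K\<bar> * 1 * norm x" for n
      using \<open>0 < \<alpha>\<close> by (intro mult_right_mono mult_mono) auto
    then show ?thesis
      using fwd[of _ x] that Q(2) by (intro bounded_orbitsI[where m=0 and c="\<bar>K\<bar> * 1 * norm x"]) (metis imageE order_trans)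
  qed
  show "x \<in> range Q" if x: "x \<in> bounded_orbits U"
  proof -
    obtain c where c: "\<And>n. norm (U n x) \<le> c" "0 < c"
      using bounded_orbitsE[OF x] by blast
    have "norm (x - Q x) \<le> \<bar>K\<bar> * c * exp (- \<alpha> * real m)" for m
    proof -
      have "norm (x - Q x) \<le> K * exp (- \<alpha> * real m) * norm (U m x)"
        by (rule bwd)
      also have "\<dots> \<le> \<bar>K\<bar> * exp (- \<alpha> * real m) * c"
        using c by (intro mult_mono) auto
      finally show ?thesis
        by (simp add: mult_ac)
    qed
    moreover have "(\<lambda>m. \<bar>K\<bar> * c * exp (- \<alpha> * real m)) \<longlonglongrightarrow> 0"
    proof -
      have "(\<lambda>m. exp (- \<alpha>) ^ m) \<longlonglongrightarrow> 0"
        using \<open>0 < \<alpha>\<close> by (intro LIMSEQ_power_zero) simp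
      then show ?thesis
        by (intro tendsto_mult_right_zero) (simp add: mult.commute flip: exp_of_nat_mult)
    qed
    ultimately have "norm (x - Q x) \<le> 0"
      by (intro LIMSEQ_le_const) auto
    then show ?thesis
      by (metis eq_iff_diff_eq_0 norm_le_zero_iff rangeI)
  qed
qed

lemma complemented_bounded_orbits:
  assumes "evolution U V" "dichotomy_projection U V Q K \<alpha>" "0 < \<alpha>"
    and s: "vector_space s" and Q_s: "\<And>c x. Q (s c x) = s c (Q x)"
  shows "complemented s (bounded_orbits U)"
proof -
  interpret vector_space s by (fact s)
  have Q: "bounded_linear Q" "\<And>x. Q (Q x) = Q x"
    using assms(2) by (auto simp: dichotomy_projection_def)
  interpret Q: bounded_linear Q by (fact Q)
  have range_iff: "x \<in> range Q \<longleftrightarrow> Q x = x" for x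
    using Q(2) by (metis imageE rangeI)
  have "subspace (range Q)" "subspace {x. Q x = 0}"
    by (auto intro!: subspaceI simp: range_iff Q.zero Q.add Q_s Q(2))
  moreover have "closed {x. Q x = 0}"
    by (intro closed_Collect_eq continuous_intros Q.continuous_on)
  moreover have "range Q \<inter> {x. Q x = 0} = {0}"
    unfolding set_eq_iff Int_iff range_iff by (auto simp: Q.zero)
  moreover have "x \<in> {u + z |u z. u \<in> range Q \<and> z \<in> {x. Q x = 0}}" for x
    by (intro CollectI exI[of _ "Q x"] exI[of _ "x - Q x"]) (simp add: Q.diff Q(2))
  ultimately show ?thesis
    unfolding complemented_def bounded_orbits_eq_range[OF assms(1-3)]
    by (intro conjI exI[of _ "{x. Q x = 0}"]) blast+
qed

section \<open>Cocycles\<close>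

lemma blinfun_eq_iff: "f = g \<longleftrightarrow> (\<forall>x. blinfun_apply f x = blinfun_apply g x)"
  by (auto intro: blinfun_eqI)

lemma invertible_blinfun_iff:
  "invertible_blinfun T \<longleftrightarrow>
    (\<exists>S. (\<forall>x. blinfun_apply S (T x) = x) \<and> (\<forall>y. T (blinfun_apply S y) = y))"
  unfolding invertible_blinfun_def blinfun_eq_iff by simp

lemma invertible_cocycle:
  assumes "\<And>n. invertible_blinfun (A n)"
  shows "invertible_blinfun (cocycle A n 0)"
proof (induction n)
  case 0
  show ?case
    unfolding invertible_blinfun_iff by (intro exI[of _ id_blinfun]) simp
next
  case (Suc n)
  then obtain S where "\<And>x. blinfun_apply S (cocycle A n 0 x) = x" "\<And>y. cocycle A n 0 (blinfun_apply S y) = y"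
    by (auto simp: invertible_blinfun_iff)
  moreover obtain T where "\<And>x. blinfun_apply T (A n x) = x" "\<And>y. A n (blinfun_apply T y) = y"
    using assms[of n] by (auto simp: invertible_blinfun_iff)
  ultimately show ?case
    unfolding invertible_blinfun_iff by (intro exI[of _ "S o\<^sub>L T"]) simp
qed

lemma evolution_cocycle:
  assumes "\<And>n. invertible_blinfun (A n)"
  obtains V where "evolution (\<lambda>n. blinfun_apply (cocycle A n 0)) V"
proof -
  have "\<exists>S. (\<forall>x. blinfun_apply S (cocycle A n 0 x) = x) \<and> (\<forall>y. cocycle A n 0 (blinfun_apply S y) = y)" for n
    using invertible_cocycle[of A n, OF assms] by (simp only: invertible_blinfun_iff)
  then obtain S where "\<And>n x. blinfun_apply (S n) (cocycle A n 0 x) = x"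
    "\<And>n x. cocycle A n 0 (blinfun_apply (S n) x) = x"
    by metis
  then have "evolution (\<lambda>n. blinfun_apply (cocycle A n 0)) (\<lambda>n. blinfun_apply (S n))"
    by (simp add: evolution_def blinfun.bounded_linear_right)
  then show thesis
    by (rule that)
qed

definition dichotomic ::
  "('k \<Rightarrow> 'a \<Rightarrow> 'a) \<Rightarrow> (nat \<Rightarrow> 'a \<Rightarrow> 'a::real_normed_vector) \<Rightarrow> (nat \<Rightarrow> 'a \<Rightarrow> 'a) \<Rightarrow> bool" where
  "dichotomic s U V \<longleftrightarrow> (\<exists>Q K \<alpha>. 0 < K \<and> 0 < \<alpha> \<and> dichotomy_projection U V Q K \<alpha> \<and>
     (\<forall>c x. Q (s c x) = s c (Q x)))"

text \<open>Invariance forces \<open>P n\<close> to be the conjugate of \<open>P 0\<close> by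
  \<open>U n\<close>, so the whole family is encoded by \<open>Q = P 0\<close>. Since
  \<open>V n\<close> inverts the full cocycle, \<open>cocycle_back\<close> on the kernels is the
  restriction of the backward transition, and the bijections between kernels are automatic for
  conjugates.\<close>

lemma exponential_dichotomy_iff_dichotomic:
  fixes A :: "nat \<Rightarrow> 'a::banach \<Rightarrow>\<^sub>L 'a" and s :: "'k::field \<Rightarrow> 'a \<Rightarrow> 'a"
  assumes s: "vector_space s" and A_s: "\<And>n c x. A n (s c x) = s c (A n x)"
    and ev: "evolution (\<lambda>n. blinfun_apply (cocycle A n 0)) V"
  shows "exponential_dichotomy s A \<longleftrightarrow> dichotomic s (\<lambda>n. blinfun_apply (cocycle A n 0)) V"
proof -
  define U where "U n = blinfun_apply (cocycle A n 0)" for n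
  interpret evolution U V
    using ev by (simp add: U_def[abs_def])
  have U_Suc: "U (Suc n) x = A n (U n x)" for n x
    by (simp add: U_def)
  have A_eq: "A n x = U (Suc n) (V n x)" for n x
    by (simp add: U_Suc)
  have cocycle_U: "cocycle A n m (U m x) = U n x" if "m \<le> n" for m n x
    using that
  proof (induction n)
    case (Suc n)
    then show ?case
      by (cases "m = Suc n") (auto simp: U_Suc)
  qed simp
  have cocycle_eq: "cocycle A n m x = U n (V m x)" if "m \<le> n" for m n x
    using cocycle_U[OF that, of "V m x"] by simp
  have U_s: "U n (s c x) = s c (U n x)" for n c x
    by (induction n) (simp_all add: U_Suc A_s)
  have V_s: "V n (s c x) = s c (V n x)" for n c x
    using arg_cong[OF U_s[of n c "V n x"], of "V n"] by simp
  show ?thesis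
    unfolding U_def[abs_def, symmetric] dichotomic_def
  proof
    assume "exponential_dichotomy s A"
    then obtain P K \<alpha> where K: "K > 0" "\<alpha> > 0"
      and P: "\<forall>n. Vector_Spaces.linear s s (blinfun_apply (P n)) \<and> P n o\<^sub>L P n = P n"
      and AP: "\<forall>n. A n o\<^sub>L P n = P (Suc n) o\<^sub>L A n \<and>
        bij_betw (blinfun_apply (A n)) (blinfun_kernel (P n)) (blinfun_kernel (P (Suc n)))"
      and fwd: "\<forall>m n. n \<le> m \<longrightarrow> norm (cocycle A m n o\<^sub>L P n) \<le> K * exp (- \<alpha> * (real m - real n))"
      and bwd: "\<forall>m n. m \<le> n \<longrightarrow> (\<forall>x. norm (cocycle_back A P m n (x - P n x))
        \<le> K * exp (- \<alpha> * (real n - real m)) * norm x)"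
      unfolding exponential_dichotomy_def by (elim exE conjE) (rule that)
    have PP: "P n (P n x) = P n x" for n x
      using P by (simp add: blinfun_eq_iff)
    have AP': "A n (P n x) = P (Suc n) (A n x)" for n x
      using AP by (simp add: blinfun_eq_iff)
    have P_U: "P n (U n x) = U n (P 0 x)" for n x
      by (induction n) (simp_all add: U_Suc flip: AP')
    have P_eq: "U n (P 0 (V n x)) = P n x" for n x
      by (simp flip: P_U)
    have V_P: "V n (P n x) = P 0 (V n x)" for n x
      by (simp add: P_eq[symmetric, of n x])
    have "decay_splitting U V (\<lambda>m x. U m (P 0 (V m x))) K \<alpha>"
      unfolding decay_splitting_def P_eq
    proof (intro conjI allI impI)
      fix m n :: nat and x
      show "norm (U n (V m (P m x))) \<le> K * exp (- \<alpha> * (real n - real m)) * norm x" if "m \<le> n"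
      proof -
        have "norm ((cocycle A n m o\<^sub>L P m) x) \<le> norm (cocycle A n m o\<^sub>L P m) * norm x"
          by (rule norm_blinfun)
        also have "\<dots> \<le> K * exp (- \<alpha> * (real n - real m)) * norm x"
          by (intro mult_right_mono fwd[rule_format] that) simp
        finally show ?thesis
          by (simp add: cocycle_eq[OF that])
      qed
      show "norm (U n (V m (x - P m x))) \<le> K * exp (- \<alpha> * (real m - real n)) * norm x" if "n \<le> m"
      proof -
        have "cocycle_back A P n m (x - P m x) = U n (V m (x - P m x))"
          unfolding cocycle_back_def
        proof (rule inv_into_f_eq)
          show "inj_on (blinfun_apply (cocycle A m n)) {x. P n x = 0}"
            by (rule inj_on_inverseI[where g="\<lambda>x. U n (V m x)"]) (simp add: cocycle_eq[OF that])
          have "P n (U n (V m (x - P m x))) = U n (V m (P m (x - P m x)))"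
            by (simp only: P_U V_P)
          then show "U n (V m (x - P m x)) \<in> {x. P n x = 0}"
            using linear_0[OF bounded_linear.linear[OF bounded_linear_U]]
              linear_0[OF bounded_linear.linear[OF bounded_linear_V]]
            by (simp add: blinfun.diff_right PP)
          show "cocycle A m n (U n (V m (x - P m x))) = x - P m x"
            by (simp add: cocycle_U[OF that])
        qed
        then show ?thesis
          using bwd[rule_format, OF that, of x] by simp
      qed
    qed
    then have "dichotomy_projection U V (P 0) K \<alpha>"
      by (simp add: dichotomy_projection_def blinfun.bounded_linear_right PP)
    then show "\<exists>Q K \<alpha>. 0 < K \<and> 0 < \<alpha> \<and> dichotomy_projection U V Q K \<alpha> \<and> (\<forall>c x. Q (s c x) = s c (Q x))"
      using K P by (intro exI[of _ "blinfun_apply (P 0)"] exI[of _ K] exI[of _ \<alpha>])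
        (simp add: Vector_Spaces.linear_iff)
  next
    assume "\<exists>Q K \<alpha>. 0 < K \<and> 0 < \<alpha> \<and> dichotomy_projection U V Q K \<alpha> \<and> (\<forall>c x. Q (s c x) = s c (Q x))"
    then obtain Q K \<alpha> where K: "0 < K" "0 < \<alpha>" and dich: "dichotomy_projection U V Q K \<alpha>"
      and Q_s: "\<And>c x. Q (s c x) = s c (Q x)"
      by blast
    have Q: "bounded_linear Q" "\<And>x. Q (Q x) = Q x"
      and split: "decay_splitting U V (\<lambda>m x. U m (Q (V m x))) K \<alpha>"
      using dich by (auto simp: dichotomy_projection_def)
    interpret Q: bounded_linear Q by (fact Q)
    define P where "P n = Blinfun (\<lambda>x. U n (Q (V n x)))" for n
    have P: "P n x = U n (Q (V n x))" for n x
      unfolding P_def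
      by (intro bounded_linear_Blinfun_apply[THEN fun_cong] bounded_linear_compose[OF bounded_linear_U]
          bounded_linear_compose[OF Q(1)] bounded_linear_V)
    have "Vector_Spaces.linear s s (blinfun_apply (P n))" for n
      unfolding Vector_Spaces.linear_iff by (simp add: s blinfun.add_right) (simp add: P U_s V_s Q_s)
    moreover have "P n o\<^sub>L P n = P n" for n
      by (rule blinfun_eqI) (simp add: P Q(2))
    moreover have "A n o\<^sub>L P n = P (Suc n) o\<^sub>L A n" for n
      by (rule blinfun_eqI) (simp add: P A_eq)
    moreover have "bij_betw (blinfun_apply (A n)) {x. P n x = 0} {x. P (Suc n) x = 0}" for n
    proof (rule bij_betwI[where g="\<lambda>x. U n (V (Suc n) x)"])
      have "U k y = 0 \<longleftrightarrow> y = 0" for k y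
        using linear_0[OF bounded_linear.linear[OF bounded_linear_U]] by (metis V_U)
      then show "blinfun_apply (A n) \<in> {x. P n x = 0} \<rightarrow> {x. P (Suc n) x = 0}"
        "(\<lambda>x. U n (V (Suc n) x)) \<in> {x. P (Suc n) x = 0} \<rightarrow> {x. P n x = 0}"
        by (auto simp: P A_eq)
    qed (simp_all add: A_eq)
    moreover have "norm (cocycle A m n o\<^sub>L P n) \<le> K * exp (- \<alpha> * (real m - real n))" if "n \<le> m" for m n
    proof (rule norm_blinfun_bound)
      show "norm ((cocycle A m n o\<^sub>L P n) x) \<le> K * exp (- \<alpha> * (real m - real n)) * norm x" for x
        using split[unfolded decay_splitting_def, THEN conjunct1, rule_format, OF that, of x]
        by (simp add: P cocycle_eq[OF that])
    qed (use K in simp)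
    moreover have "norm (cocycle_back A P m n (x - P n x)) \<le> K * exp (- \<alpha> * (real n - real m)) * norm x"
      if "m \<le> n" for m n x
    proof -
      have "cocycle_back A P m n (x - P n x) = U m (V n (x - P n x))"
        unfolding cocycle_back_def
      proof (rule inv_into_f_eq)
        show "inj_on (blinfun_apply (cocycle A n m)) {x. P m x = 0}"
          by (rule inj_on_inverseI[where g="\<lambda>x. U m (V n x)"]) (simp add: cocycle_eq[OF that])
        show "U m (V n (x - P n x)) \<in> {x. P m x = 0}"
          using linear_0[OF bounded_linear.linear[OF bounded_linear_U]]
          by (simp add: P V_diff Q.diff Q(2))
        show "cocycle A n m (U m (V n (x - P n x))) = x - P n x"
          by (simp add: cocycle_U[OF that])
      qed
      then show ?thesis
        using split[unfolded decay_splitting_def, THEN conjunct2, rule_format, OF that, of x]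
        by (simp add: P)
    qed
    ultimately show "exponential_dichotomy s A"
      unfolding exponential_dichotomy_def using K by (intro exI[of _ P] exI[of _ K] exI[of _ \<alpha>]) simp
  qed
qed

section \<open>Duality\<close>

lemma bounded_linear_adjoint:
  fixes f :: "'a::{real_inner,banach} \<Rightarrow> 'b::real_inner"
  assumes "bounded_linear f"
  shows "bounded_linear (adjoint f)"
proof -
  note adj = inner_adjoint_eq[OF assms]
  obtain B where B: "0 \<le> B" "\<And>x. norm (f x) \<le> B * norm x"
    using bounded_linear.nonneg_bounded[OF assms] by (auto simp: mult.commute)
  show ?thesis
  proof (rule bounded_linear_intro)
    show "adjoint f (x + y) = adjoint f x + adjoint f y" for x y
      by (subst vector_eq_ldot[symmetric]) (simp add: inner_add_right flip: adj)
    show "adjoint f (r *\<^sub>R x) = r *\<^sub>R adjoint f x" for r x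
      by (subst vector_eq_ldot[symmetric]) (simp flip: adj)
    show "norm (adjoint f y) \<le> norm y * B" for y
      using norm_adjoint_le[of f "adjoint f", OF adj B(2,1)] by (simp add: mult.commute)
  qed
qed

lemma adjoint_adjoint_eq:
  fixes f :: "'a::{real_inner,banach} \<Rightarrow> 'b::real_inner"
  assumes "bounded_linear f"
  shows "adjoint (adjoint f) = f"
  by (rule adjoint_unique) (metis inner_adjoint_eq[OF assms] inner_commute)

lemma (in hilbert_space) inner_scale_scale: "inner (scale c x) (scale c y) = (norm c)\<^sup>2 * inner x y"
  unfolding dot_norm by (simp add: norm_scale power_mult_distrib algebra_simps flip: scale_right_distrib)

text \<open>The real inner product does not display the conjugated scalar. Instead the test vector
  is written as \<open>scale c z\<close>; both sides then become
  \<open>(norm c)\<^sup>2 * inner z (adjoint f w)\<close>.\<close>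

lemma (in hilbert_space) adjoint_scale:
  assumes f: "bounded_linear f" "\<And>c x. f (scale c x) = scale c (f x)"
  shows "adjoint f (scale c w) = scale c (adjoint f w)"
proof (cases "c = 0")
  case True
  then show ?thesis
    by (simp add: linear_0[OF bounded_linear.linear[OF bounded_linear_adjoint[OF f(1)]]])
next
  case False
  note adj = inner_adjoint_eq[OF f(1)]
  have "inner y (adjoint f (scale c w)) = inner y (scale c (adjoint f w))" for y
  proof -
    define z where "z = scale (1 / c) y"
    have y: "y = scale c z"
      using False by (simp add: z_def)
    have "inner y (adjoint f (scale c w)) = inner (scale c (f z)) (scale c w)"
      by (simp add: y f(2) flip: adj)
    also have "\<dots> = inner y (scale c (adjoint f w))"
      by (simp add: y inner_scale_scale adj)
    finally show ?thesis .
  qed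
  then show ?thesis
    using vector_eq_ldot by blast
qed

lemma evolution_adjoint:
  fixes U V :: "nat \<Rightarrow> 'a::{real_inner,banach} \<Rightarrow> 'a"
  assumes "evolution U V"
  shows "evolution (\<lambda>n. adjoint (V n)) (\<lambda>n. adjoint (U n))"
proof -
  interpret evolution U V by (fact assms)
  note adjU = inner_adjoint_eq[OF bounded_linear_U] and adjV = inner_adjoint_eq[OF bounded_linear_V]
  have "adjoint (V n) (adjoint (U n) x) = x" "adjoint (U n) (adjoint (V n) x) = x"
    "adjoint (V 0) x = x" for n x
    by (subst vector_eq_ldot[symmetric], simp flip: adjU adjV)+
  then show ?thesis
    by (simp add: evolution_def bounded_linear_adjoint bounded_linear_U bounded_linear_V)
qed

text \<open>Adjoints reverse composition: the dual transition from \<open>m\<close> to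
  \<open>n\<close> after \<open>x - adjoint (R m) x\<close> is the adjoint of the transition from
  \<open>n\<close> to \<open>m\<close> followed by the complement of \<open>R m\<close>. Hence
  \<open>R m\<close> stands after the transition in the hypotheses, unlike in
  \<open>decay_splitting\<close>, and forward and backward decay change places.\<close>

lemma decay_splitting_adjoint:
  fixes U V :: "nat \<Rightarrow> 'a::{real_inner,banach} \<Rightarrow> 'a"
  assumes "evolution U V" and R: "\<And>m. bounded_linear (R m)" and "0 \<le> K"
    and est1: "\<And>m n y. m \<le> n \<Longrightarrow>
      norm (U m (V n y) - R m (U m (V n y))) \<le> K * exp (- \<alpha> * (real n - real m)) * norm y"
    and est2: "\<And>m n y. n \<le> m \<Longrightarrow>
      norm (R m (U m (V n y))) \<le> K * exp (- \<alpha> * (real m - real n)) * norm y"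
  shows "decay_splitting (\<lambda>n. adjoint (V n)) (\<lambda>n. adjoint (U n)) (\<lambda>m x. x - adjoint (R m) x) K \<alpha>"
proof -
  interpret evolution U V by (fact assms(1))
  note adj = inner_adjoint_eq[OF bounded_linear_U] inner_adjoint_eq[OF bounded_linear_V]
    inner_adjoint_eq[OF R]
  show ?thesis
    unfolding decay_splitting_def
  proof (intro conjI allI impI)
    fix m n :: nat and x
    show "norm (adjoint (V n) (adjoint (U m) (x - adjoint (R m) x)))
        \<le> K * exp (- \<alpha> * (real n - real m)) * norm x" if "m \<le> n"
    proof (rule norm_adjoint_le)
      show "inner (U m (V n y) - R m (U m (V n y))) z
          = inner y (adjoint (V n) (adjoint (U m) (z - adjoint (R m) z)))" for y z
        by (simp add: inner_diff_left inner_diff_right flip: adj)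
    qed (use est1[OF that] \<open>0 \<le> K\<close> in auto)
    show "norm (adjoint (V n) (adjoint (U m) (x - (x - adjoint (R m) x))))
        \<le> K * exp (- \<alpha> * (real m - real n)) * norm x" if "n \<le> m"
    proof (rule norm_adjoint_le)
      show "inner (R m (U m (V n y))) z
          = inner y (adjoint (V n) (adjoint (U m) (z - (z - adjoint (R m) z))))" for y z
        by (simp flip: adj)
    qed (use est2[OF that] \<open>0 \<le> K\<close> in auto)
  qed
qed

text \<open>Conjugates of one projection commute with transitions, so applying them before or after
  makes no difference. Duality exchanges stable and unstable parts, hence the projection
  \<open>\<lambda>x. x - adjoint Q x\<close>.\<close>

lemma dichotomic_adjoint:
  fixes U V :: "nat \<Rightarrow> 'a::{real_inner,banach} \<Rightarrow> 'a"
  assumes "evolution U V" and s: "hilbert_space s" and "dichotomic s U V"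
  shows "dichotomic s (\<lambda>n. adjoint (V n)) (\<lambda>n. adjoint (U n))"
proof -
  interpret evolution U V by (fact assms(1))
  interpret hilbert_space s by (fact s)
  obtain Q K \<alpha> where K: "0 < K" "0 < \<alpha>" and dich: "dichotomy_projection U V Q K \<alpha>"
    and Q_s: "\<And>c x. Q (s c x) = s c (Q x)"
    using assms(3) by (auto simp: dichotomic_def)
  have Q: "bounded_linear Q" "\<And>x. Q (Q x) = Q x"
    and split: "decay_splitting U V (\<lambda>m x. U m (Q (V m x))) K \<alpha>"
    using dich by (auto simp: dichotomy_projection_def)
  define R where "R m x = U m (Q (V m x))" for m x
  have R: "bounded_linear (R m)" for m
    unfolding R_def[abs_def] by (intro bounded_linear_compose[OF bounded_linear_U]
        bounded_linear_compose[OF Q(1)] bounded_linear_V)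
  note adj = inner_adjoint_eq[OF bounded_linear_U] inner_adjoint_eq[OF bounded_linear_V]
    inner_adjoint_eq[OF Q(1)]
  have adjR: "adjoint (R m) = (\<lambda>x. adjoint (V m) (adjoint Q (adjoint (U m) x)))" for m
    by (rule adjoint_unique) (simp add: R_def adj)
  interpret dual: evolution "\<lambda>n. adjoint (V n)" "\<lambda>n. adjoint (U n)"
    by (rule evolution_adjoint) (fact assms(1))
  interpret Q': bounded_linear "adjoint Q"
    by (rule bounded_linear_adjoint) (fact Q)
  have "decay_splitting (\<lambda>n. adjoint (V n)) (\<lambda>n. adjoint (U n)) (\<lambda>m x. x - adjoint (R m) x) K \<alpha>"
  proof (rule decay_splitting_adjoint[OF assms(1) R])
    fix m n :: nat and y
    show "norm (U m (V n y) - R m (U m (V n y))) \<le> K * exp (- \<alpha> * (real n - real m)) * norm y" if "m \<le> n"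
      using split[unfolded decay_splitting_def, THEN conjunct2, rule_format, OF that, of y]
      by (simp add: R_def V_diff U_diff)
    show "norm (R m (U m (V n y))) \<le> K * exp (- \<alpha> * (real m - real n)) * norm y" if "n \<le> m"
      using split[unfolded decay_splitting_def, THEN conjunct1, rule_format, OF that, of y]
      by (simp add: R_def)
  qed (use K in simp)
  moreover have "(\<lambda>m x. x - adjoint (R m) x)
      = (\<lambda>m x. adjoint (V m) (adjoint (U m) x - adjoint Q (adjoint (U m) x)))"
    by (simp add: adjR dual.U_diff fun_eq_iff)
  moreover have "adjoint Q (adjoint Q x) = adjoint Q x" for x
    by (subst vector_eq_ldot[symmetric]) (simp add: Q(2) flip: adj)
  ultimately have "dichotomy_projection (\<lambda>n. adjoint (V n)) (\<lambda>n. adjoint (U n)) (\<lambda>x. x - adjoint Q x) K \<alpha>"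
    unfolding dichotomy_projection_def
    by (simp add: bounded_linear_sub Q'.bounded_linear_axioms Q'.diff)
  then show ?thesis
    unfolding dichotomic_def using K adjoint_scale[OF Q(1) Q_s]
    by (intro exI[of _ "\<lambda>x. x - adjoint Q x"] exI[of _ K] exI[of _ \<alpha>])
      (simp add: scale_right_diff_distrib)
qed

lemma dichotomic_adjoint_iff:
  fixes U V :: "nat \<Rightarrow> 'a::{real_inner,banach} \<Rightarrow> 'a"
  assumes "evolution U V" and "hilbert_space s"
  shows "dichotomic s (\<lambda>n. adjoint (V n)) (\<lambda>n. adjoint (U n)) \<longleftrightarrow> dichotomic s U V"
  using dichotomic_adjoint[OF assms] dichotomic_adjoint[OF evolution_adjoint[OF assms(1)] assms(2)]
    evolution.bounded_linear_U[OF assms(1)] evolution.bounded_linear_V[OF assms(1)]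
  by (auto simp: adjoint_adjoint_eq)

lemma dichotomic_iff_complemented:
  assumes "evolution U V" and s: "hilbert_space s"
    and "decay_splitting U V R K \<alpha>" "0 < K" "0 < \<alpha>"
  shows "dichotomic s U V \<longleftrightarrow> complemented s (bounded_orbits U)"
proof
  interpret hilbert_space s by (fact s)
  show "complemented s (bounded_orbits U)" if "dichotomic s U V"
    using that complemented_bounded_orbits[OF assms(1) _ _ vector_space_axioms]
    unfolding dichotomic_def by blast
  show "dichotomic s U V" if "complemented s (bounded_orbits U)"
    using dichotomy_projection_of_decay_splitting[OF assms(1) vector_space_axioms scale_of_real that assms(3-5)]
      \<open>0 < \<alpha>\<close> unfolding dichotomic_def by metis
qed

section \<open>Products and block triangular systems\<close>

text \<open>\<open>\<pi>\<close> intertwines the evolutions while \<open>\<iota>\<close> is merely a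
  section of it. The model is \<open>snd\<close> with \<open>(0, x)\<close>: the second summand is
  not invariant under a triangular system. Contractivity of both maps preserves the constant
  \<open>K\<close>.\<close>

locale evolution_quotient = big: evolution U V + small: evolution W Y
  for U V :: "nat \<Rightarrow> 'a::banach \<Rightarrow> 'a" and W Y :: "nat \<Rightarrow> 'b::banach \<Rightarrow> 'b" +
  fixes \<iota> :: "'b \<Rightarrow> 'a" and \<pi> :: "'a \<Rightarrow> 'b"
  assumes linear_\<pi>: "bounded_linear \<pi>" and norm_\<pi>: "norm (\<pi> p) \<le> norm p"
    and norm_\<iota>: "norm (\<iota> x) \<le> norm x"
    and \<pi>_\<iota> [simp]: "\<pi> (\<iota> x) = x"
    and \<pi>_U: "\<pi> (U n p) = W n (\<pi> p)"
begin

lemma \<pi>_V: "\<pi> (V n p) = Y n (\<pi> p)"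
  using arg_cong[OF \<pi>_U[of n "V n p"], of "Y n"] by simp

lemma \<pi>_diff: "\<pi> (x - y) = \<pi> x - \<pi> y"
  by (rule linear_diff[OF bounded_linear.linear[OF linear_\<pi>]])

lemma decay_splitting_quotient:
  assumes split: "decay_splitting U V R K \<alpha>" and "0 < K"
  shows "decay_splitting W Y (\<lambda>m x. \<pi> (R m (\<iota> x))) K \<alpha>"
proof -
  have bound: "norm (\<pi> z) \<le> K * exp t * norm x" if "norm z \<le> K * exp t * norm (\<iota> x)" for z t x
  proof -
    have "K * exp t * norm (\<iota> x) \<le> K * exp t * norm x"
      using \<open>0 < K\<close> by (intro mult_left_mono norm_\<iota>) auto
    then show ?thesis
      using that norm_\<pi>[of z] by linarith
  qed
  have "W n (Y m (x - \<pi> (R m (\<iota> x)))) = \<pi> (U n (V m (\<iota> x - R m (\<iota> x))))" for n m x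
    by (simp add: \<pi>_U \<pi>_V \<pi>_diff)
  then show ?thesis
    using split by (simp add: decay_splitting_def bound flip: \<pi>_U \<pi>_V)
qed

end

text \<open>
  The operator \<open>\<lambda>x. \<pi> (Q (\<iota> x))\<close> is idempotent because the range of \<open>Q\<close> consists of the bounded
  orbits and is therefore invariant under \<open>\<lambda>p. \<iota> (\<pi> p)\<close>.
\<close>

lemma dichotomic_retract:
  assumes "evolution_quotient U V W Y \<iota> \<pi>"
    and \<iota>: "bounded_linear \<iota>" "\<And>n x. U n (\<iota> x) = \<iota> (W n x)" "\<And>c x. \<iota> (s' c x) = s c (\<iota> x)"
    and \<pi>: "\<And>c p. \<pi> (s c p) = s' c (\<pi> p)"
    and "dichotomic s U V"
  shows "dichotomic s' W Y"
proof -
  interpret evolution_quotient U V W Y \<iota> \<pi> by (fact assms(1))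
  obtain Q K \<alpha> where K: "0 < K" "0 < \<alpha>" and dich: "dichotomy_projection U V Q K \<alpha>"
    and Q_s: "\<And>c x. Q (s c x) = s c (Q x)"
    using assms(6) by (auto simp: dichotomic_def)
  have Q: "bounded_linear Q" "\<And>x. Q (Q x) = Q x"
    and split: "decay_splitting U V (\<lambda>m x. U m (Q (V m x))) K \<alpha>"
    using dich by (auto simp: dichotomy_projection_def)
  have \<iota>_V: "V n (\<iota> x) = \<iota> (Y n x)" for n x
    using arg_cong[OF \<iota>(2)[of n "Y n x"], of "V n"] by simp
  have "decay_splitting W Y (\<lambda>m x. W m (\<pi> (Q (\<iota> (Y m x))))) K \<alpha>"
    using decay_splitting_quotient[OF split K(1)] by (simp add: \<pi>_U \<iota>_V)
  moreover have "\<pi> (Q (\<iota> (\<pi> (Q (\<iota> x))))) = \<pi> (Q (\<iota> x))" for x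
  proof -
    let ?p = "Q (\<iota> x)"
    have "?p \<in> bounded_orbits U"
      using bounded_orbits_eq_range[OF big.evolution_axioms dich K(2)] by blast
    then obtain c where c: "\<And>n. norm (U n ?p) \<le> c" "0 < c"
      using bounded_orbitsE by blast
    have "norm (U n (\<iota> (\<pi> ?p))) \<le> c" for n
    proof -
      have "norm (U n (\<iota> (\<pi> ?p))) = norm (\<iota> (\<pi> (U n ?p)))"
        by (simp add: \<iota>(2) \<pi>_U)
      also have "\<dots> \<le> c"
        using norm_\<iota> norm_\<pi> c(1) by (meson order_trans)
      finally show ?thesis .
    qed
    then have "\<iota> (\<pi> ?p) \<in> range Q"
      using bounded_orbitsI[of 0 U "\<iota> (\<pi> ?p)" c]
        bounded_orbits_eq_range[OF big.evolution_axioms dich K(2)] by blast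
    then have "Q (\<iota> (\<pi> ?p)) = \<iota> (\<pi> ?p)"
      using Q(2) by auto
    then show ?thesis
      by simp
  qed
  moreover have "bounded_linear (\<lambda>x. \<pi> (Q (\<iota> x)))"
    by (intro bounded_linear_compose[OF linear_\<pi>] bounded_linear_compose[OF Q(1)] \<iota>(1))
  ultimately have "dichotomy_projection W Y (\<lambda>x. \<pi> (Q (\<iota> x))) K \<alpha>"
    by (simp add: dichotomy_projection_def)
  then show ?thesis
    unfolding dichotomic_def using K
    by (intro exI[of _ "\<lambda>x. \<pi> (Q (\<iota> x))"] exI[of _ K] exI[of _ \<alpha>]) (simp add: \<iota>(3) \<pi> Q_s)
qed

lemma decay_splitting_mono:
  assumes "decay_splitting U V R K \<alpha>" "0 \<le> K" "K \<le> K'" "\<alpha>' \<le> \<alpha>"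
  shows "decay_splitting U V R K' \<alpha>'"
proof -
  have le: "K * exp (- \<alpha> * (real a - real b)) * norm x \<le> K' * exp (- \<alpha>' * (real a - real b)) * norm x"
    if "b \<le> a" for a b :: nat and x :: 'a
    using assms that by (intro mult_right_mono mult_mono) (auto simp: mult_right_mono)
  show ?thesis
    using assms(1) unfolding decay_splitting_def by (meson le order_trans)
qed

lemma evolution_map_prod:
  assumes "evolution U1 V1" "evolution U2 V2"
  shows "evolution (\<lambda>n. map_prod (U1 n) (U2 n)) (\<lambda>n. map_prod (V1 n) (V2 n))"
proof -
  interpret e1: evolution U1 V1 by (fact assms)
  interpret e2: evolution U2 V2 by (fact assms)
  have bl: "bounded_linear (map_prod f g)" if "bounded_linear f" "bounded_linear g"
    for f :: "'c::banach \<Rightarrow> 'c" and g :: "'d::banach \<Rightarrow> 'd"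
    unfolding map_prod_def case_prod_beta
    by (intro bounded_linear_Pair bounded_linear_compose[OF that(1)] bounded_linear_compose[OF that(2)]
        bounded_linear_fst bounded_linear_snd)
  show ?thesis
    by (auto simp: evolution_def bl e1.bounded_linear_U e1.bounded_linear_V e2.bounded_linear_U e2.bounded_linear_V)
qed

text \<open>In a diagonal system both summands are invariant, so \<open>dichotomic_retract\<close>
  applies to each; the dichotomy of the product need not come from a diagonal projection. The
  converse takes the product projection with the slower rate.\<close>

lemma dichotomic_map_prod:
  fixes U1 V1 :: "nat \<Rightarrow> 'a::banach \<Rightarrow> 'a" and U2 V2 :: "nat \<Rightarrow> 'b::banach \<Rightarrow> 'b"
    and s1 :: "'k::field \<Rightarrow> 'a \<Rightarrow> 'a" and s2 :: "'k \<Rightarrow> 'b \<Rightarrow> 'b"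
  assumes "evolution U1 V1" "evolution U2 V2" "vector_space s1" "vector_space s2"
  shows "dichotomic (module_prod.scale s1 s2)
      (\<lambda>n. map_prod (U1 n) (U2 n)) (\<lambda>n. map_prod (V1 n) (V2 n)) \<longleftrightarrow>
    dichotomic s1 U1 V1 \<and> dichotomic s2 U2 V2"
    (is "?L \<longleftrightarrow> _")
proof (intro iffI conjI)
  interpret e1: evolution U1 V1 by (fact assms)
  interpret e2: evolution U2 V2 by (fact assms)
  interpret vector_space_prod s1 s2
    by (intro vector_space_prod.intro vector_space_pair.intro assms)
  let ?U = "\<lambda>n. map_prod (U1 n) (U2 n)" and ?V = "\<lambda>n. map_prod (V1 n) (V2 n)"
  have ev: "evolution ?U ?V"
    by (rule evolution_map_prod[OF assms(1,2)])
  have zero: "U1 n 0 = 0" "U2 n 0 = 0" for n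
    using e1.U_diff[of n 0 0] e2.U_diff[of n 0 0] by auto
  show "dichotomic s1 U1 V1" if ?L
  proof (rule dichotomic_retract[where \<iota>="\<lambda>x. (x, 0)" and \<pi>=fst, OF _ _ _ _ _ that])
    show "evolution_quotient ?U ?V U1 V1 (\<lambda>x. (x, 0)) fst"
      by (intro evolution_quotient.intro evolution_quotient_axioms.intro ev assms)
        (auto simp: bounded_linear_fst norm_fst_le norm_Pair)
    show "bounded_linear (\<lambda>x::'a. (x, 0::'b))"
      by (intro bounded_linear_Pair bounded_linear_ident bounded_linear_zero)
  qed (auto simp: zero scale_def)
  show "dichotomic s2 U2 V2" if ?L
  proof (rule dichotomic_retract[where \<iota>="\<lambda>x. (0, x)" and \<pi>=snd, OF _ _ _ _ _ that])
    show "evolution_quotient ?U ?V U2 V2 (\<lambda>x. (0, x)) snd"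
      by (intro evolution_quotient.intro evolution_quotient_axioms.intro ev assms)
        (auto simp: bounded_linear_snd norm_snd_le norm_Pair)
    show "bounded_linear (\<lambda>x::'b. (0::'a, x))"
      by (intro bounded_linear_Pair bounded_linear_ident bounded_linear_zero)
  qed (auto simp: zero scale_def)
  assume "dichotomic s1 U1 V1 \<and> dichotomic s2 U2 V2"
  then obtain Q1 K1 \<alpha>1 Q2 K2 \<alpha>2 where K: "0 < K1" "0 < \<alpha>1" "0 < K2" "0 < \<alpha>2"
    and d1: "dichotomy_projection U1 V1 Q1 K1 \<alpha>1" and s1: "\<And>c x. Q1 (s1 c x) = s1 c (Q1 x)"
    and d2: "dichotomy_projection U2 V2 Q2 K2 \<alpha>2" and s2: "\<And>c x. Q2 (s2 c x) = s2 c (Q2 x)"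
    unfolding dichotomic_def by auto
  define K where "K = max K1 K2"
  define \<alpha> where "\<alpha> = min \<alpha>1 \<alpha>2"
  have Q1: "bounded_linear Q1" "\<And>x. Q1 (Q1 x) = Q1 x" and Q2: "bounded_linear Q2" "\<And>x. Q2 (Q2 x) = Q2 x"
    using d1 d2 by (auto simp: dichotomy_projection_def)
  have split1: "decay_splitting U1 V1 (\<lambda>m x. U1 m (Q1 (V1 m x))) K \<alpha>"
    by (rule decay_splitting_mono[where K=K1 and \<alpha>=\<alpha>1])
      (use d1 K in \<open>auto simp: dichotomy_projection_def K_def \<alpha>_def\<close>)
  have split2: "decay_splitting U2 V2 (\<lambda>m x. U2 m (Q2 (V2 m x))) K \<alpha>"
    by (rule decay_splitting_mono[where K=K2 and \<alpha>=\<alpha>2])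
      (use d2 K in \<open>auto simp: dichotomy_projection_def K_def \<alpha>_def\<close>)
  \<comment> \<open>The product norm is bounded by the sum of the component norms, hence the factor
    2.\<close>
  have pair: "norm (x, y) \<le> 2 * K * exp t * norm p"
    if "norm x \<le> K * exp t * norm (fst p)" "norm y \<le> K * exp t * norm (snd p)"
    for x :: 'a and y :: 'b and t and p :: "'a \<times> 'b"
  proof -
    have "K * exp t * norm (fst p) \<le> K * exp t * norm p" "K * exp t * norm (snd p) \<le> K * exp t * norm p"
      using K norm_fst_le[of "fst p" "snd p"] norm_snd_le[of "snd p" "fst p"]
      by (auto simp: K_def intro!: mult_left_mono)
    then show ?thesis
      using that norm_Pair_le[of x y] by linarith
  qed
  have "decay_splitting ?U ?V (\<lambda>m x. ?U m (map_prod Q1 Q2 (?V m x))) (2 * K) \<alpha>"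
    using split1 split2 unfolding decay_splitting_def
    by (auto intro!: pair simp: map_prod_def case_prod_beta)
  moreover have "bounded_linear (map_prod Q1 Q2)"
    unfolding map_prod_def case_prod_beta
    by (intro bounded_linear_Pair bounded_linear_compose[OF Q1(1)] bounded_linear_compose[OF Q2(1)]
        bounded_linear_fst bounded_linear_snd)
  ultimately have "dichotomy_projection ?U ?V (map_prod Q1 Q2) (2 * K) \<alpha>"
    using Q1(2) Q2(2) by (auto simp: dichotomy_projection_def)
  then show ?L
    unfolding dichotomic_def using K s1 s2
    by (intro exI[of _ "map_prod Q1 Q2"] exI[of _ "2 * K"] exI[of _ \<alpha>])
      (auto simp: K_def \<alpha>_def scale_def)
qed

section \<open>Inverses and cocycles of block triangular systems\<close>

lemma invertible_block_upper:
  assumes "invertible_blinfun A" "invertible_blinfun D"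
  shows "invertible_blinfun (block_upper A B D)"
proof -
  obtain S T where "\<And>x. blinfun_apply S (A x) = x" "\<And>x. A (blinfun_apply S x) = x"
    "\<And>x. blinfun_apply T (D x) = x" "\<And>x. D (blinfun_apply T x) = x"
    using assms by (auto simp: invertible_blinfun_iff)
  then show ?thesis
    unfolding invertible_blinfun_iff
    by (intro exI[of _ "block_upper S (- (S o\<^sub>L B o\<^sub>L T)) T"])
      (auto simp: blinfun_apply_block_upper blinfun.add_right blinfun.diff_right
        blinfun.minus_left blinfun.minus_right)
qed

lemma cocycle_block_upper_Pair_0:
  "cocycle (\<lambda>n. block_upper (A n) (B n) (D n)) n 0 (x, 0) = (cocycle A n 0 x, 0)"
  by (induction n) (simp_all add: blinfun_apply_block_upper)

lemma snd_cocycle_block_upper: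
  "snd (cocycle (\<lambda>n. block_upper (A n) (B n) (D n)) n 0 p) = cocycle D n 0 (snd p)"
proof (induction n)
  case (Suc n)
  then show ?case
    by (cases "cocycle (\<lambda>n. block_upper (A n) (B n) (D n)) n 0 p") (simp add: blinfun_apply_block_upper)
qed simp

lemma cocycle_block_diagonal:
  "blinfun_apply (cocycle (\<lambda>n. block_upper (A n) 0 (D n)) n 0) = map_prod (cocycle A n 0) (cocycle D n 0)"
proof
  fix p
  show "cocycle (\<lambda>n. block_upper (A n) 0 (D n)) n 0 p = map_prod (cocycle A n 0) (cocycle D n 0) p"
    by (cases p, induction n) (simp_all add: blinfun_apply_block_upper)
qed

theorem theorem9:
  fixes s1 :: "'k::real_normed_field \<Rightarrow> 'a::{real_inner, banach} \<Rightarrow> 'a"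
    and s2 :: "'k \<Rightarrow> 'b::{real_inner, banach} \<Rightarrow> 'b"
    and A11 :: "nat \<Rightarrow> 'a \<Rightarrow>\<^sub>L 'a"
    and A12 :: "nat \<Rightarrow> 'b \<Rightarrow>\<^sub>L 'a"
    and A22 :: "nat \<Rightarrow> 'b \<Rightarrow>\<^sub>L 'b"
  assumes "hilbert_space s1" and "hilbert_space s2"
    and "\<And>n. Vector_Spaces.linear s1 s1 (blinfun_apply (A11 n))"
    and "\<And>n. Vector_Spaces.linear s2 s1 (blinfun_apply (A12 n))"
    and "\<And>n. Vector_Spaces.linear s2 s2 (blinfun_apply (A22 n))"
    and "\<And>n. invertible_blinfun (A11 n)"
    and "\<And>n. invertible_blinfun (A22 n)"
    and "exponential_dichotomy (module_prod.scale s1 s2)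
           (\<lambda>n. block_upper (A11 n) (A12 n) (A22 n))"
  shows "exponential_dichotomy (module_prod.scale s1 s2)
           (\<lambda>n. block_upper (A11 n) 0 (A22 n))
         \<longleftrightarrow>
         complemented s2
           {v2. bdd_above (range (\<lambda>n. norm (blinfun_apply (cocycle A22 n 0) v2)))} \<and>
         complemented s1
           {v1. bdd_above (range (\<lambda>n. norm (inv (adjoint (blinfun_apply (cocycle A11 n 0))) v1)))}"
proof -
  interpret h1: hilbert_space s1 by (fact assms)
  interpret h2: hilbert_space s2 by (fact assms)
  interpret vector_space_prod s1 s2
    by (intro vector_space_prod.intro vector_space_pair.intro h1.vector_space_axioms h2.vector_space_axioms)
  let ?s = "module_prod.scale s1 s2"
  let ?T = "\<lambda>n. block_upper (A11 n) (A12 n) (A22 n)" and ?D = "\<lambda>n. block_upper (A11 n) 0 (A22 n)"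
  let ?U = "\<lambda>n. blinfun_apply (cocycle ?T n 0)"
  let ?U1 = "\<lambda>n. blinfun_apply (cocycle A11 n 0)" and ?U2 = "\<lambda>n. blinfun_apply (cocycle A22 n 0)"
  obtain V1 where V1: "evolution ?U1 V1"
    using evolution_cocycle[of A11] assms(6) by blast
  obtain V2 where V2: "evolution ?U2 V2"
    using evolution_cocycle[of A22] assms(7) by blast
  obtain V where V: "evolution ?U V"
    using evolution_cocycle[of ?T] invertible_block_upper assms(6,7) by blast
  interpret e1: evolution ?U1 V1 by (fact V1)
  interpret e2: evolution ?U2 V2 by (fact V2)
  interpret e: evolution ?U V by (fact V)
  have lin: "A11 n (s1 c x) = s1 c (A11 n x)" "A12 n (s2 c y) = s1 c (A12 n y)"
    "A22 n (s2 c y) = s2 c (A22 n y)" for n c x y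
    using assms(3-5) by (auto simp: Vector_Spaces.linear_iff)
  have lin_T: "?T n (?s c x) = ?s c (?T n x)" and lin_D: "?D n (?s c x) = ?s c (?D n x)" for n c x
    by (cases x; simp add: scale_def blinfun_apply_block_upper lin h1.scale_right_distrib)+
  have ev_D: "evolution (\<lambda>n. blinfun_apply (cocycle ?D n 0)) (\<lambda>n. map_prod (V1 n) (V2 n))"
    unfolding cocycle_block_diagonal by (rule evolution_map_prod[OF V1 V2])
  have diagonal: "exponential_dichotomy ?s ?D \<longleftrightarrow> dichotomic s1 ?U1 V1 \<and> dichotomic s2 ?U2 V2"
    unfolding exponential_dichotomy_iff_dichotomic[OF p.vector_space_axioms lin_D ev_D] cocycle_block_diagonal
    by (rule dichotomic_map_prod[OF V1 V2 h1.vector_space_axioms h2.vector_space_axioms])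
  have "dichotomic ?s ?U V"
    using assms(8) exponential_dichotomy_iff_dichotomic[OF p.vector_space_axioms lin_T V] by simp
  then obtain Q K \<alpha> where K: "0 < K" "0 < \<alpha>" and dich: "dichotomy_projection ?U V Q K \<alpha>"
    unfolding dichotomic_def by blast
  have Q: "bounded_linear Q" and split: "decay_splitting ?U V (\<lambda>m x. ?U m (Q (V m x))) K \<alpha>"
    using dich by (auto simp: dichotomy_projection_def)
  \<comment> \<open>The second block is the quotient of the triangular system by the invariant
    subspace of vectors \<open>(x, 0)\<close>, so the lower right corner of the projections splits
    it.\<close>
  have "evolution_quotient ?U V ?U2 V2 (\<lambda>x. (0, x)) snd"
    by (intro evolution_quotient.intro evolution_quotient_axioms.intro V V2)
      (auto simp: bounded_linear_snd norm_snd_le norm_Pair snd_cocycle_block_upper)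
  from evolution_quotient.decay_splitting_quotient[OF this split K(1)]
  have dich2: "dichotomic s2 ?U2 V2 \<longleftrightarrow> complemented s2 (bounded_orbits ?U2)"
    by (rule dichotomic_iff_complemented[OF V2 assms(2) _ K])
  have V_Pair_0: "V n (x, 0) = (V1 n x, 0)" for n x
    using e.V_U[of n "(V1 n x, 0)"] by (simp add: cocycle_block_upper_Pair_0)
  \<comment> \<open>The upper left corner of the projection at time \<open>m\<close>. The inclusion
    \<open>(x, 0)\<close> commutes with transitions and \<open>fst\<close> in general does not, so
    estimates are available for \<open>R m\<close> applied after a transition, exactly the form
    required for the dual system.\<close>
  define R where "R m x = fst (?U m (Q (V m (x, 0))))" for m x
  have R: "bounded_linear (R m)" for m
    unfolding R_def[abs_def]
    by (intro bounded_linear_compose[OF bounded_linear_fst] bounded_linear_compose[OF e.bounded_linear_U]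
        bounded_linear_compose[OF Q] bounded_linear_compose[OF e.bounded_linear_V]
        bounded_linear_Pair bounded_linear_ident bounded_linear_zero)
  have "decay_splitting (\<lambda>n. adjoint (V1 n)) (\<lambda>n. adjoint (?U1 n)) (\<lambda>m x. x - adjoint (R m) x) K \<alpha>"
  proof (rule decay_splitting_adjoint[OF V1 R])
    fix m n :: nat and y :: 'a
    have fst_le: "norm (fst z) \<le> C * norm y" if "norm z \<le> C * norm (y, 0::'b)" for z :: "'a \<times> 'b" and C
      using that norm_fst_le[of "fst z" "snd z"] by (simp add: norm_Pair)
    have R_eq: "R m (?U1 m (V1 n y)) = fst (?U m (Q (V n (y, 0))))"
      by (simp add: R_def V_Pair_0)
    have U_eq: "?U1 m (V1 n y) = fst (?U m (V n (y, 0)))"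
      by (simp add: V_Pair_0 cocycle_block_upper_Pair_0)
    show "norm (?U1 m (V1 n y) - R m (?U1 m (V1 n y))) \<le> K * exp (- \<alpha> * (real n - real m)) * norm y"
      if "m \<le> n"
      using fst_le[OF split[unfolded decay_splitting_def, THEN conjunct2, rule_format, OF that]]
      unfolding R_eq unfolding U_eq by (simp add: e.V_diff e.U_diff)
    show "norm (R m (?U1 m (V1 n y))) \<le> K * exp (- \<alpha> * (real m - real n)) * norm y" if "n \<le> m"
      using fst_le[OF split[unfolded decay_splitting_def, THEN conjunct1, rule_format, OF that]]
      unfolding R_eq by simp
  qed (use K in simp)
  \<comment> \<open>The complement condition decides the dichotomy of the dual system; biduality
    carries it back to the first block.\<close>
  then have dich1: "dichotomic s1 ?U1 V1 \<longleftrightarrow> complemented s1 (bounded_orbits (\<lambda>n. adjoint (V1 n)))"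
    using dichotomic_iff_complemented[OF evolution_adjoint[OF V1] assms(1) _ K]
      dichotomic_adjoint_iff[OF V1 assms(1)] by blast
  interpret dual: evolution "\<lambda>n. adjoint (V1 n)" "\<lambda>n. adjoint (?U1 n)"
    by (rule evolution_adjoint[OF V1])
  have "inv (adjoint (?U1 n)) = adjoint (V1 n)" for n
    by (rule inv_equality) simp_all
  then show ?thesis
    using diagonal dich1 dich2 by (auto simp: bounded_orbits_def)
qed

end
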